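(* Let $\varphi:\mathbb H\to\mathbb H$ be holomorphic. The composition operator $C_\varphi$ is bounded on $H^2(\mathbb H)$ if and only if $\varphi$ has a finite angular derivative $0<\lambda<\infty$ at infinity (that is, $\varphi(\infty)=\infty$ and $\varphi'(\infty)=\lambda$ exists as a finite non-tangential limit), in which case $\|C_\varphi\|=\sqrt{\lambda}$.
   Context: $\mathbb H=\{z\in\mathbb C:\Re z>0\}$ is the open right half-plane. $H^2(\mathbb H)$ is the Hilbert space of holomorphic functions $f$ on $\mathbb H$ with $\|f\|^2=\sup_{x>0}\frac{1}{2\pi}\int_{-\infty}^{\infty}|f(x+iy)|^2\,dy<\infty$. For a holomorphic map $\varphi:\mathbb H\to\mathbb H$, the composition operator is $C_\varphi f=f\circ\varphi$; it is bounded on $H^2(\mathbb H)$ if it maps $H^2(\mathbb H)$ into itself and is a bounded operator there, and $\|C_\varphi\|$ is its operator norm. A sequence $z_n=x_n+iy_n$ in $\mathbb H$ approaches $\infty$ non-tangentially if $x_n\to\infty$ and the ratios $|y_n|/x_n$ are uniformly bounded. The map $\varphi$ fixes infinity non-tangentially, written $\varphi(\infty)=\infty$, if $\varphi(z_n)\to\infty$ whenever $z_n\to\infty$ non-tangentially. If $\varphi(\infty)=\infty$, then $\varphi$ has a finite angular derivative at $\infty$ if the non-tangential limit $\lim_{z\to\infty}\frac{z}{\varphi(z)}$ exists and is finite (i.e. the limit exists, with the same value, along every sequence in $\mathbb H$ approaching $\infty$ non-tangentially); this limit is denoted $\varphi'(\infty)$. *)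

theory Defs
  imports "HOL-Complex_Analysis.Complex_Analysis"
begin

definition right_half_plane :: "complex set" where
  "right_half_plane = {z. Re z > 0}"

text \<open>
  Elements of the Hardy space are represented by functions on all of \<open>\<complex>\<close>; their values
  outside the half-plane are irrelevant, and two representatives are regarded as the same
  element iff they agree on the half-plane.  The squared norm is taken in \<open>[0,\<infinity>]\<close>.
\<close>

definition hardy_norm_sq :: "(complex \<Rightarrow> complex) \<Rightarrow> ennreal" where
  "hardy_norm_sq f =
     (SUP x\<in>{0<..}. ennreal (1 / (2 * pi)) * (\<integral>\<^sup>+ y. ennreal ((cmod (f (Complex x y)))\<^sup>2) \<partial>lborel))"

definition hardy_space :: "(complex \<Rightarrow> complex) set" where
  "hardy_space = {f. f holomorphic_on right_half_plane \<and> hardy_norm_sq f < \<infinity>}"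

text \<open>Meaningful only on \<^const>\<open>hardy_space\<close>, since \<^const>\<open>enn2real\<close> sends \<open>\<infinity>\<close> to \<open>0\<close>.\<close>

definition hardy_norm :: "(complex \<Rightarrow> complex) \<Rightarrow> real" where
  "hardy_norm f = sqrt (enn2real (hardy_norm_sq f))"

definition composition_operator ::
    "(complex \<Rightarrow> complex) \<Rightarrow> (complex \<Rightarrow> complex) \<Rightarrow> (complex \<Rightarrow> complex)" where
  "composition_operator \<phi> f = f \<circ> \<phi>"

definition bounded_hardy_operator ::
    "((complex \<Rightarrow> complex) \<Rightarrow> (complex \<Rightarrow> complex)) \<Rightarrow> bool" where
  "bounded_hardy_operator T \<longleftrightarrow>
     (\<forall>f\<in>hardy_space. T f \<in> hardy_space) \<and>
     (\<forall>f\<in>hardy_space. \<forall>g\<in>hardy_space. \<forall>a b. \<forall>z\<in>right_half_plane.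
        T (\<lambda>w. a * f w + b * g w) z = a * T f z + b * T g z) \<and>
     (\<exists>C. \<forall>f\<in>hardy_space. hardy_norm (T f) \<le> C * hardy_norm f)"

text \<open>A supremum in \<open>\<real>\<close>, hence meaningful only for bounded operators.\<close>

definition hardy_operator_norm ::
    "((complex \<Rightarrow> complex) \<Rightarrow> (complex \<Rightarrow> complex)) \<Rightarrow> real" where
  "hardy_operator_norm T = (SUP f\<in>{f\<in>hardy_space. hardy_norm f \<le> 1}. hardy_norm (T f))"

definition nontangential_to_infinity :: "(nat \<Rightarrow> complex) \<Rightarrow> bool" where
  "nontangential_to_infinity z \<longleftrightarrow>
     (\<forall>n. z n \<in> right_half_plane) \<and>
     filterlim (\<lambda>n. Re (z n)) at_top sequentially \<and>
     (\<exists>M. \<forall>n. \<bar>Im (z n)\<bar> / Re (z n) \<le> M)"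

definition fixes_infinity :: "(complex \<Rightarrow> complex) \<Rightarrow> bool" where
  "fixes_infinity \<phi> \<longleftrightarrow>
     (\<forall>z. nontangential_to_infinity z \<longrightarrow> filterlim (\<lambda>n. \<phi> (z n)) at_infinity sequentially)"

text \<open>The quotient is \<open>z / \<phi>(z)\<close> rather than \<open>\<phi>(z) / z\<close>: the dilation \<open>\<phi>(z) = c z\<close> has angular
  derivative \<open>1 / c\<close> at infinity.\<close>

definition has_angular_derivative_at_infinity :: "(complex \<Rightarrow> complex) \<Rightarrow> complex \<Rightarrow> bool" where
  "has_angular_derivative_at_infinity \<phi> L \<longleftrightarrow>
     fixes_infinity \<phi> \<and>
     (\<forall>z. nontangential_to_infinity z \<longrightarrow> (\<lambda>n. z n / \<phi> (z n)) \<longlonglongrightarrow> L)"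

end

theory Submission
  imports Defs "HOL-Real_Asymp.Real_Asymp"
begin

text \<open>
  By Julia's lemma, \<open>\<phi>\<close> has a positive finite angular derivative at infinity iff
  \<open>c = inf Re (\<phi> z) / Re z\<close> is positive, and then the derivative is \<open>1 / c\<close>.

  If \<open>Re (\<phi> z) \<ge> c Re z\<close>, then on the line \<open>Re z = x\<close> the function \<open>\<bar>f\<bar>\<^sup>2 \<circ> \<phi>\<close> is dominated by the Poisson
  integral of \<open>\<bar>f\<bar>\<^sup>2\<close> over a line \<open>Re z = a < c x\<close>, evaluated at \<open>\<phi> z\<close>. The Poisson kernel at \<open>\<phi> z\<close> is the
  real part of a holomorphic function of \<open>z\<close>, whose integral along vertical lines is at most \<open>1 / c\<close>, and
  Tonelli's theorem bounds the squared norm of the operator by \<open>1 / c\<close>.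

  Conversely, if the operator has norm \<open>C\<close>, comparing the reproducing kernels at \<open>\<phi> w\<close> and
  \<open>w\<close> gives \<open>Re w \<le> C\<^sup>2 Re (\<phi> w)\<close>.
\<close>

section \<open>Poisson's formula on the half-plane\<close>

text \<open>The primitive \<open>arctan ((y - b) / A) / A\<close> has the limits
  \<open>pi / (2 * A)\<close> and \<open>- pi / (2 * A)\<close> at the two ends. The value gives
  both the total mass of the Poisson kernel and the norms of the reproducing kernels below.\<close>

lemma has_bochner_integral_inverse_quadratic:
  fixes A b :: real
  assumes A: "A > 0"
  shows "has_bochner_integral lborel (\<lambda>y. 1 / (A\<^sup>2 + (y - b)\<^sup>2)) (pi / A)"
proof -
  define F where "F y = arctan ((y - b) / A) / A" for y
  have der: "DERIV F y :> 1 / (A\<^sup>2 + (y - b)\<^sup>2)" for y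
    unfolding F_def
  proof -
    have e: "A * (A * (1 + ((y - b) / A)\<^sup>2)) = A\<^sup>2 + (y - b)\<^sup>2"
      using A by (simp add: power_divide distrib_left power2_eq_square)
    have "DERIV (\<lambda>y. arctan ((y - b) / A) / A) y :> (1 / A) / (1 + ((y - b) / A)\<^sup>2) / A"
      by (rule derivative_eq_intros refl | (use A in simp; fail))+ (use A in \<open>simp add: divide_simps\<close>)
    thus "DERIV (\<lambda>y. arctan ((y - b) / A) / A) y :> 1 / (A\<^sup>2 + (y - b)\<^sup>2)"
      unfolding e[symmetric] by (simp add: mult.commute mult.left_commute)
  qed
  have pos: "0 < A\<^sup>2 + (y - b)\<^sup>2" for y
    using A by (simp add: add_pos_nonneg)
  have cont: "isCont (\<lambda>y. 1 / (A\<^sup>2 + (y - b)\<^sup>2)) y" for y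
    using pos[of y] by (intro continuous_intros) auto
  have top: "((F \<circ> real_of_ereal) \<longlongrightarrow> pi / 2 / A) (at_left \<infinity>)"
    unfolding F_def o_def at_left_PInf filterlim_filtermap real_of_ereal.simps
    using A by (real_asymp simp: field_simps)
  have bot: "((F \<circ> real_of_ereal) \<longlongrightarrow> - (pi / 2) / A) (at_right (- \<infinity>))"
    unfolding F_def o_def at_right_MInf filterlim_filtermap real_of_ereal.simps
    using A by (real_asymp simp: field_simps)
  have nonneg: "AE y in lborel. - \<infinity> < ereal y \<longrightarrow> ereal y < \<infinity> \<longrightarrow> 0 \<le> 1 / (A\<^sup>2 + (y - b)\<^sup>2)"
    using pos by (auto intro: less_imp_le)
  note FTC = interval_integral_FTC_nonneg[of "- \<infinity>" \<infinity> F, OF _ der cont nonneg bot top]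
  have "integrable lborel (\<lambda>y. 1 / (A\<^sup>2 + (y - b)\<^sup>2))"
    using FTC(1) by (simp add: set_integrable_def)
  moreover have "(LBINT y. 1 / (A\<^sup>2 + (y - b)\<^sup>2)) = pi / A"
    using FTC(2) A by (simp add: interval_lebesgue_integral_def set_lebesgue_integral_def field_simps)
  ultimately show ?thesis
    by (simp add: has_bochner_integral_iff)
qed

text \<open>The segment from \<open>- \<i> n\<close> to \<open>\<i> n\<close> is closed up by a
  semicircle in the right half-plane. Quadratic decay makes the arc contribute only O(1/n). The
  point \<open>w\<close> leaves room for a removable singularity, at which continuity is all that is
  known.\<close>

lemma integral_imaginary_axis_eq_0:
  fixes F :: "complex \<Rightarrow> complex" and w :: complex and C :: real
  assumes cont: "continuous_on {z. Re z \<ge> 0} F"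
    and diff: "\<And>z. Re z > 0 \<Longrightarrow> z \<noteq> w \<Longrightarrow> F field_differentiable at z"
    and decay: "\<And>z. Re z \<ge> 0 \<Longrightarrow> cmod z > cmod w \<Longrightarrow> cmod (F z) \<le> C / (cmod z - cmod w)\<^sup>2"
    and int: "integrable lborel (\<lambda>y. F (Complex 0 y))"
  shows "(LBINT y. F (Complex 0 y)) = 0"
proof -
  define S where "S = {z :: complex. Re z \<ge> 0}"
  define G where "G y = F (Complex 0 y)" for y
  define R where "R = cmod w"
  \<comment> \<open>At the real point \<open>R + 1\<close> the denominator of the decay bound equals
    1.\<close>
  have C0: "C \<ge> 0"
  proof -
    have "0 \<le> cmod (F (of_real (R + 1)))" by simp
    also have "\<dots> \<le> C"
      using decay[of "of_real (R + 1)"] by (simp add: R_def)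
    finally show ?thesis .
  qed
  have bound: "cmod (integral {- real n..real n} G) \<le> C / (real n - R)\<^sup>2 * real n * pi"
    if n: "real n > R" for n
  proof -
    have n0: "real n > 0" using n unfolding R_def by (meson le_less_trans norm_ge_zero)
    define arc where "arc = part_circlepath 0 (real n) (- (pi / 2)) (pi / 2)"
    define seg where "seg = linepath (Complex 0 (real n)) (Complex 0 (- real n))"
    have e1: "exp (\<i> * of_real (pi / 2)) = \<i>" and e2: "exp (\<i> * of_real (- (pi / 2))) = - \<i>"
      by (simp_all only: cis_conv_exp[symmetric]) (simp_all add: complex_eq_iff)
    have ends: "pathstart arc = Complex 0 (- real n)" "pathfinish arc = Complex 0 (real n)"
      unfolding arc_def pathstart_part_circlepath pathfinish_part_circlepath e1 e2
      by (simp_all add: complex_eq_iff)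
    have arcS: "path_image arc \<subseteq> S"
      using n0 by (auto simp: arc_def path_image_part_circlepath S_def closed_segment_eq_real_ivl
          Re_exp intro!: mult_nonneg_nonneg cos_ge_zero)
    have segS: "path_image seg \<subseteq> S"
      unfolding seg_def S_def path_image_linepath
      by (intro closed_segment_subset convex_halfspace_Re_ge) auto
    \<comment> \<open>Cauchy's theorem on a convex set tolerates finitely many interior points where
      \<open>F\<close> is merely continuous; here the exceptional set is \<open>{w}\<close>.\<close>
    have "(F has_contour_integral 0) (arc +++ seg)"
    proof (rule Cauchy_theorem_convex[of S F "{w}"])
      show "convex S" unfolding S_def by (rule convex_halfspace_Re_ge)
      have int: "interior S = {z. Re z > 0}"
        unfolding S_def using interior_halfspace_ge[of "1 :: complex" 0] by (simp add: inner_complex_def)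
      show "F field_differentiable at z" if "z \<in> interior S - {w}" for z
        using that diff unfolding int by auto
      show "valid_path (arc +++ seg)"
        using ends by (intro valid_path_join) (auto simp: arc_def seg_def)
      show "path_image (arc +++ seg) \<subseteq> S"
        using arcS segS by (intro subset_path_image_join)
      show "pathfinish (arc +++ seg) = pathstart (arc +++ seg)"
        using ends by (simp add: seg_def)
    qed (use cont in \<open>auto simp: S_def\<close>)
    moreover have ia: "F contour_integrable_on arc"
      unfolding arc_def
      by (intro contour_integrable_continuous_part_circlepath continuous_on_subset[OF cont])
         (use arcS in \<open>simp add: S_def arc_def\<close>)
    moreover have "F contour_integrable_on seg"
      unfolding seg_def
      by (intro contour_integrable_continuous_linepath continuous_on_subset[OF cont])
         (use segS in \<open>simp add: S_def seg_def\<close>)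
    ultimately have sum0: "contour_integral arc F + contour_integral seg F = 0"
      using contour_integral_join[of F arc seg] contour_integral_unique ends
      by (metis arc_def seg_def pathstart_linepath valid_path_linepath valid_path_part_circlepath)
    have "contour_integral seg F = - contour_integral (linepath (Complex 0 (- real n)) (Complex 0 (real n))) F"
      unfolding seg_def
      by (rule contour_integral_reverse_linepath[symmetric, THEN minus_equation_iff[THEN iffD1], symmetric])
         (use segS in \<open>auto intro!: continuous_on_subset[OF cont] simp: S_def seg_def closed_segment_commute\<close>)
    hence arcseg: "contour_integral arc F = contour_integral (linepath (Complex 0 (- real n)) (Complex 0 (real n))) F"
      using sum0 by simp
    have "F contour_integrable_on linepath (Complex 0 (- real n)) (Complex 0 (real n))"
      by (intro contour_integrable_continuous_linepath continuous_on_subset[OF cont])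
         (use segS in \<open>simp add: S_def seg_def closed_segment_commute\<close>)
    \<comment> \<open>On the upward segment dz = \<open>\<i>\<close> dy, hence the factor
      \<open>- \<i>\<close> when returning to an integral over the real parameter.\<close>
    hence "(G has_integral (- \<i> * contour_integral arc F)) {- real n..real n}"
      unfolding G_def arcseg
      by (subst has_contour_integral_linepath_same_Re_iff[symmetric])
         (use n0 in \<open>auto intro: has_contour_integral_integral\<close>)
    hence "cmod (integral {- real n..real n} G) = cmod (contour_integral arc F)"
      by (auto dest!: integral_unique simp: norm_mult)
    also have "\<dots> \<le> C / (real n - R)\<^sup>2 * real n * (pi / 2 - (- (pi / 2)))"
    proof (rule has_contour_integral_bound_part_circlepath[of F])
      show "(F has_contour_integral contour_integral arc F) (part_circlepath 0 (real n) (- (pi / 2)) (pi / 2))"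
        using ia unfolding arc_def by (rule has_contour_integral_integral)
      fix z assume z: "z \<in> path_image (part_circlepath 0 (real n) (- (pi / 2)) (pi / 2))"
      hence "cmod z = real n"
        using in_path_image_part_circlepath[OF z] n0 by auto
      moreover have "Re z \<ge> 0" using z arcS by (auto simp: arc_def S_def)
      ultimately show "cmod (F z) \<le> C / (real n - R)\<^sup>2"
        using decay[of z] n by (simp add: R_def)
    qed (use n0 C0 in auto)
    finally show ?thesis by simp
  qed
  have lim0: "(\<lambda>n. integral {- real n..real n} G) \<longlonglongrightarrow> 0"
  proof (rule Lim_null_comparison)
    show "\<forall>\<^sub>F n in sequentially. norm (integral {- real n..real n} G) \<le> C / (real n - R)\<^sup>2 * real n * pi"
      using eventually_gt_at_top[of "nat \<lceil>R\<rceil>"] by eventually_elim (rule bound, linarith)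
    show "(\<lambda>n. C / (real n - R)\<^sup>2 * real n * pi) \<longlonglongrightarrow> 0"
      by real_asymp
  qed
  have eq: "integral {- real n..real n} G = (LBINT y. indicator {- real n..real n} y *\<^sub>R G y)" for n
    using set_borel_integral_eq_integral(2)[of "{- real n..real n}" G] int
    by (simp add: G_def set_lebesgue_integral_def set_integrable_def integrable_mult_indicator)
  \<comment> \<open>The contour argument only controls symmetric truncations. Since \<open>G\<close>
    is integrable, dominated convergence identifies their limit with the full integral.\<close>
  have "(\<lambda>n. LBINT y. indicator {- real n..real n} y *\<^sub>R G y) \<longlonglongrightarrow> (LBINT y. G y)"
  proof (rule integral_dominated_convergence[where w="\<lambda>y. norm (G y)"])
    show "AE y in lborel. (\<lambda>n. indicator {- real n..real n} y *\<^sub>R G y) \<longlonglongrightarrow> G y"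
    proof (rule AE_I2, rule tendsto_eventually)
      fix y :: real
      show "\<forall>\<^sub>F n in sequentially. indicator {- real n..real n} y *\<^sub>R G y = G y"
        using eventually_gt_at_top[of "nat \<lceil>\<bar>y\<bar>\<rceil>"]
      proof eventually_elim
        fix n assume "n > nat \<lceil>\<bar>y\<bar>\<rceil>"
        hence "y \<in> {- real n..real n}" by (auto simp: abs_real_def split: if_splits) linarith+
        thus "indicator {- real n..real n} y *\<^sub>R G y = G y" by simp
      qed
    qed
  qed (use int in \<open>auto simp: G_def indicator_def\<close>)
  with lim0 show ?thesis
    unfolding eq G_def by (rule LIMSEQ_unique[rotated])
qed

text \<open>On the imaginary axis (z - w)(z + cnj w) equals -|z - w|^2. So the integral of
  \<open>F\<close> there is the difference of the Poisson integrals of the constant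
  \<open>q w\<close> and of \<open>q\<close>, and it vanishes by the previous lemma.\<close>

lemma poisson_formula:
  fixes q :: "complex \<Rightarrow> complex"
  assumes cont: "continuous_on {z. Re z \<ge> 0} q"
    and hol: "q holomorphic_on {z. Re z > 0}"
    and bdd: "\<And>z. Re z \<ge> 0 \<Longrightarrow> cmod (q z) \<le> M"
    and w: "Re w > 0"
  shows "has_bochner_integral lborel (\<lambda>y. q (Complex 0 y) / of_real ((cmod (Complex 0 y - w))\<^sup>2)) (q w * of_real (pi / Re w))"
proof -
  \<comment> \<open>The difference quotient is completed continuously at \<open>w\<close>. The
    second factor has its pole at \<open>- cnj w\<close>, outside the closed half-plane, and
    supplies the second power of decay that a bounded \<open>q\<close> alone would not give.\<close>
  define F where "F z = (if z = w then deriv q w else (q z - q w) / (z - w)) / (z + cnj w)" for z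
  have opn: "open {z. Re z > 0}" by (simp add: open_halfspace_Re_gt)
  have M0: "M \<ge> 0" using bdd[of 0] norm_ge_zero[of "q 0"] by (simp del: norm_ge_zero)
  have nz: "z + cnj w \<noteq> 0" if "Re z \<ge> 0" for z
    using that w by (auto simp: complex_eq_iff)
  have der: "(q has_field_derivative deriv q w) (at w)"
    using hol opn w by (auto intro: holomorphic_derivI)
  have cont_F: "continuous_on {z. Re z \<ge> 0} F"
    unfolding F_def
  proof (intro continuous_on_divide continuous_intros nz)
    show "continuous_on {z. 0 \<le> Re z} (\<lambda>z. if z = w then deriv q w else (q z - q w) / (z - w))"
      unfolding continuous_on_eq_continuous_within
    proof
      fix z assume z: "z \<in> {z. 0 \<le> Re z}"
      show "continuous (at z within {z. 0 \<le> Re z}) (\<lambda>z. if z = w then deriv q w else (q z - q w) / (z - w))"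
      proof (cases "z = w")
        case True
        have "((\<lambda>z. (q z - q w) / (z - w)) \<longlongrightarrow> deriv q w) (at w)"
          using der by (simp add: has_field_derivative_iff)
        hence "((\<lambda>z. (q z - q w) / (z - w)) \<longlongrightarrow> deriv q w) (at w within {z. 0 \<le> Re z})"
          by (rule tendsto_within_subset) simp
        thus ?thesis unfolding True continuous_within
          by (auto elim!: Lim_transform_eventually simp: eventually_at_filter)
      next
        case False
        have c: "continuous (at z within {z. 0 \<le> Re z}) (\<lambda>z. (q z - q w) / (z - w))"
          using cont z False by (intro continuous_intros) (auto simp: continuous_on_eq_continuous_within)
        have "\<forall>\<^sub>F x in at z within {z. 0 \<le> Re z}. x \<noteq> w"
          using False by (auto intro!: eventually_at_topological[THEN iffD2] exI[of _ "- {w}"])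
        with c False show ?thesis unfolding continuous_within
          by (auto elim!: Lim_transform_eventually elim: eventually_mono)
      qed
    qed
  qed (use nz in auto)
  have diff_F: "F field_differentiable at z" if z: "Re z > 0" "z \<noteq> w" for z
  proof -
    have "(\<lambda>z. (q z - q w) / (z - w) / (z + cnj w)) holomorphic_on ({z. Re z > 0} - {w})"
      using nz by (intro holomorphic_intros holomorphic_on_subset[OF hol]) auto
    hence "F holomorphic_on ({z. Re z > 0} - {w})"
      by (rule holomorphic_transform) (auto simp: F_def)
    moreover have "open ({z. Re z > 0} - {w})" using opn by auto
    ultimately show ?thesis
      using z by (intro holomorphic_on_imp_differentiable_at) auto
  qed
  have qd: "cmod (q z - q w) \<le> 2 * M" if "Re z \<ge> 0" for z
    using norm_triangle_ineq4[of "q z" "q w"] bdd[OF that] bdd[of w] w by linarith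
  have decay: "cmod (F z) \<le> 2 * M / (cmod z - cmod w)\<^sup>2" if z: "Re z \<ge> 0" "cmod z > cmod w" for z
  proof -
    have zw: "z \<noteq> w" using z by auto
    have "cmod z - cmod w \<le> cmod (z - w)" by (rule norm_triangle_ineq2)
    moreover have "cmod z - cmod w \<le> cmod (z + cnj w)"
      using norm_triangle_ineq2[of z "- cnj w"] by simp
    ultimately have "(cmod z - cmod w)\<^sup>2 \<le> cmod (z - w) * cmod (z + cnj w)"
      unfolding power2_eq_square using z by (intro mult_mono) auto
    hence "cmod (q z - q w) / (cmod (z - w) * cmod (z + cnj w)) \<le> 2 * M / (cmod z - cmod w)\<^sup>2"
      using z M0 qd by (intro frac_le) auto
    thus ?thesis using zw by (simp add: F_def norm_divide norm_mult)
  qed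
  have k: "(cmod (Complex 0 y - w))\<^sup>2 = (Re w)\<^sup>2 + (y - Im w)\<^sup>2" for y
    by (simp add: cmod_power2)
  have kpos: "(Re w)\<^sup>2 + (y - Im w)\<^sup>2 > 0" for y using w by (simp add: add_pos_nonneg)
  note P = has_bochner_integral_inverse_quadratic[OF w, of "Im w"]
  have cont_q: "continuous_on UNIV (\<lambda>y. q (Complex 0 y))"
    by (intro continuous_on_compose2[OF cont]) (auto intro!: continuous_intros)
  have int_q: "integrable lborel (\<lambda>y. q (Complex 0 y) / of_real ((cmod (Complex 0 y - w))\<^sup>2))"
  proof (rule Bochner_Integration.integrable_bound)
    show "integrable lborel (\<lambda>y. M * (1 / ((Re w)\<^sup>2 + (y - Im w)\<^sup>2)))"
      using P by (intro integrable_mult_right) (simp add: has_bochner_integral_iff)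
    show "AE y in lborel. norm (q (Complex 0 y) / of_real ((cmod (Complex 0 y - w))\<^sup>2)) \<le> norm (M * (1 / ((Re w)\<^sup>2 + (y - Im w)\<^sup>2)))"
      unfolding k using bdd M0 kpos
      by (intro AE_I2) (auto simp: norm_divide norm_power abs_mult simp del: of_real_add of_real_power intro!: divide_right_mono)
    show "(\<lambda>y. q (Complex 0 y) / of_real ((cmod (Complex 0 y - w))\<^sup>2)) \<in> borel_measurable lborel"
      using borel_measurable_continuous_onI[OF cont_q] unfolding k by measurable
  qed
  have int_c: "has_bochner_integral lborel (\<lambda>y. q w / of_real ((cmod (Complex 0 y - w))\<^sup>2)) (q w * of_real (pi / Re w))"
    using has_bochner_integral_mult_right[OF has_bochner_integral_of_real[OF P], of "q w"]
    unfolding k by simp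
  have FG: "F (Complex 0 y) = q w / of_real ((cmod (Complex 0 y - w))\<^sup>2) - q (Complex 0 y) / of_real ((cmod (Complex 0 y - w))\<^sup>2)" for y
  proof -
    have "(Complex 0 y - w) * (Complex 0 y + cnj w) = - ((Complex 0 y - w) * cnj (Complex 0 y - w))"
      by (simp add: complex_eq_iff algebra_simps)
    also have "\<dots> = - of_real ((cmod (Complex 0 y - w))\<^sup>2)"
      by (simp only: complex_norm_square)
    finally have "(Complex 0 y - w) * (Complex 0 y + cnj w) = - of_real ((cmod (Complex 0 y - w))\<^sup>2)" .
    moreover have "Complex 0 y \<noteq> w" using w by auto
    ultimately show ?thesis by (simp add: F_def diff_divide_distrib)
  qed
  have "integrable lborel (\<lambda>y. F (Complex 0 y))"
    unfolding FG using int_q int_c by (intro Bochner_Integration.integrable_diff) (auto simp: has_bochner_integral_iff)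
  from integral_imaginary_axis_eq_0[OF cont_F diff_F decay this]
  have "(LBINT y. q w / of_real ((cmod (Complex 0 y - w))\<^sup>2)) = (LBINT y. q (Complex 0 y) / of_real ((cmod (Complex 0 y - w))\<^sup>2))"
    unfolding FG using int_q int_c by (simp add: has_bochner_integral_iff)
  with int_q int_c show ?thesis by (simp add: has_bochner_integral_iff)
qed

lemma poisson_formula_shifted:
  fixes h :: "complex \<Rightarrow> complex"
  assumes hol: "h holomorphic_on {z. Re z > b}" and ab: "b < a"
    and bdd: "\<And>z. Re z \<ge> a \<Longrightarrow> cmod (h z) \<le> M"
    and w: "Re w > a"
  shows "has_bochner_integral lborel (\<lambda>y. h (Complex a y) / of_real ((cmod (Complex a y - w))\<^sup>2))
           (h w * of_real (pi / (Re w - a)))"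
proof -
  define q where "q z = h (z + of_real a)" for z
  have "q holomorphic_on {z. Re z > b - a}"
    unfolding q_def
    by (intro holomorphic_on_compose_gen[OF _ hol, unfolded o_def] holomorphic_intros) auto
  hence "continuous_on {z. Re z \<ge> 0} q" "q holomorphic_on {z. Re z > 0}"
    using ab by (auto intro!: holomorphic_on_imp_continuous_on elim!: holomorphic_on_subset)
  moreover have "cmod (q z) \<le> M" if "Re z \<ge> 0" for z
    using that by (auto simp: q_def intro: bdd)
  ultimately have "has_bochner_integral lborel
      (\<lambda>y. q (Complex 0 y) / of_real ((cmod (Complex 0 y - (w - of_real a)))\<^sup>2))
      (q (w - of_real a) * of_real (pi / Re (w - of_real a)))"
    using w by (intro poisson_formula) auto
  moreover have "Complex 0 y + of_real a = Complex a y" "Complex 0 y - (w - of_real a) = Complex a y - w" for y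
    by (auto simp: complex_eq_iff)
  ultimately show ?thesis by (simp add: q_def)
qed

text \<open>Poisson's formula at the point x + N, with N = \<open>Suc n\<close>, integrates
  \<open>Re q\<close> against the weight N^2 / (N^2 + y^2), with value pi N Re q(x + N). The decay
  of \<open>q\<close> keeps this below \<open>pi * K\<close>, the weights tend to 1, and Fatou's
  lemma passes to the limit because the integrands are nonnegative.\<close>

lemma line_integral_positive_real_part_le:
  fixes q :: "complex \<Rightarrow> complex"
  assumes hol: "q holomorphic_on {z. Re z > b}" and bx: "b < x"
    and pos: "\<And>z. Re z \<ge> x \<Longrightarrow> Re (q z) \<ge> 0"
    and bdd: "\<And>z. Re z \<ge> x \<Longrightarrow> cmod (q z) \<le> K / (Re z - b)"
  shows "(\<integral>\<^sup>+ y. ennreal (Re (q (Complex x y))) \<partial>lborel) \<le> ennreal (pi * K)"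
proof -
  have K: "K \<ge> 0"
    using order_trans[OF norm_ge_zero bdd[of "of_real x"]] bx by (simp add: zero_le_divide_iff)
  define u where "u n y = (real (Suc n))\<^sup>2 / ((real (Suc n))\<^sup>2 + y\<^sup>2) * Re (q (Complex x y))" for n y
  have u_nonneg: "0 \<le> u n y" for n y
    unfolding u_def by (intro mult_nonneg_nonneg pos divide_nonneg_nonneg) auto
  have bdd': "cmod (q z) \<le> K / (x - b)" if "Re z \<ge> x" for z
    using bdd[OF that] that bx K by (meson divide_left_mono diff_right_mono diff_gt_0_iff_gt le_less_trans
        mult_pos_pos order_trans less_le_trans)
  have u_int: "has_bochner_integral lborel (u n) (pi * (real (Suc n) * Re (q (of_real (x + real (Suc n))))))" for n
  proof -
    have "has_bochner_integral lborel (\<lambda>y. (real (Suc n))\<^sup>2 *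
        Re (q (Complex x y) / of_real ((cmod (Complex x y - of_real (x + real (Suc n))))\<^sup>2)))
       ((real (Suc n))\<^sup>2 * Re (q (of_real (x + real (Suc n))) * of_real (pi / (Re (of_real (x + real (Suc n))) - x))))"
      by (intro has_bochner_integral_mult_right has_bochner_integral_Re poisson_formula_shifted[OF hol bx bdd'])
         auto
    also have "(\<lambda>y. (real (Suc n))\<^sup>2 *
        Re (q (Complex x y) / of_real ((cmod (Complex x y - of_real (x + real (Suc n))))\<^sup>2))) = u n"
      by (auto simp: u_def cmod_power2 simp del: of_real_add of_nat_Suc of_real_power)
    also have "(real (Suc n))\<^sup>2 * Re (q (of_real (x + real (Suc n))) * of_real (pi / (Re (of_real (x + real (Suc n))) - x)))
       = pi * (real (Suc n) * Re (q (of_real (x + real (Suc n)))))"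
      by (simp add: power2_eq_square del: of_nat_Suc of_real_add)
    finally show ?thesis .
  qed
  have u_meas: "u n \<in> borel_measurable lborel" for n
    using u_int[of n] unfolding has_bochner_integral_iff by (blast intro: borel_measurable_integrable)
  have u_le: "(\<integral>\<^sup>+ y. ennreal (u n y) \<partial>lborel) \<le> ennreal (pi * K)" for n
  proof -
    have "real (Suc n) * Re (q (of_real (x + real (Suc n)))) \<le> real (Suc n) * (K / (x + real (Suc n) - b))"
      using bdd[of "of_real (x + real (Suc n))"] complex_Re_le_cmod[of "q (of_real (x + real (Suc n)))"]
      by (intro mult_left_mono) (auto simp del: of_nat_Suc of_real_add)
    also have "\<dots> = K * (real (Suc n) / (x + real (Suc n) - b))" by simp
    also have "\<dots> \<le> K * 1"
      using K bx by (intro mult_left_mono) (auto simp: field_simps)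
    finally have "real (Suc n) * Re (q (of_real (x + real (Suc n)))) \<le> K" by simp
    hence "ennreal (pi * (real (Suc n) * Re (q (of_real (x + real (Suc n)))))) \<le> ennreal (pi * K)"
      by (intro ennreal_leI mult_left_mono) auto
    thus ?thesis
      using u_int[of n] u_nonneg
      by (simp add: has_bochner_integral_iff nn_integral_eq_integral del: of_nat_Suc of_real_add)
  qed
  have lim: "(\<lambda>n. ennreal (u n y)) \<longlonglongrightarrow> ennreal (Re (q (Complex x y)))" for y
  proof (rule tendsto_ennrealI)
    have "(\<lambda>n. (real (Suc n))\<^sup>2 / ((real (Suc n))\<^sup>2 + y\<^sup>2)) \<longlonglongrightarrow> 1"
      by real_asymp
    from tendsto_mult[OF this tendsto_const] show "(\<lambda>n. u n y) \<longlonglongrightarrow> Re (q (Complex x y))"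
      by (simp add: u_def del: of_nat_Suc)
  qed
  have "(\<integral>\<^sup>+ y. ennreal (Re (q (Complex x y))) \<partial>lborel) = (\<integral>\<^sup>+ y. liminf (\<lambda>n. ennreal (u n y)) \<partial>lborel)"
    using lim_imp_Liminf[OF sequentially_bot lim] by simp
  also have "\<dots> \<le> liminf (\<lambda>n. \<integral>\<^sup>+ y. ennreal (u n y) \<partial>lborel)"
    using u_meas by (intro nn_integral_liminf measurable_compose[OF _ measurable_ennreal])
  also have "\<dots> \<le> ennreal (pi * K)"
    using u_le by (intro Liminf_le) auto
  finally show ?thesis .
qed

section \<open>The Hardy space\<close>

lemma hardy_norm_power2: "f \<in> hardy_space \<Longrightarrow> ennreal ((hardy_norm f)\<^sup>2) = hardy_norm_sq f"
  by (simp add: hardy_space_def hardy_norm_def top.not_eq_extremum)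

lemma hardy_line_integral_le:
  assumes f: "f \<in> hardy_space" and x: "x > 0"
  shows "(\<integral>\<^sup>+ y. ennreal ((cmod (f (Complex x y)))\<^sup>2) \<partial>lborel) \<le> ennreal (2 * pi * (hardy_norm f)\<^sup>2)"
proof -
  let ?I = "\<integral>\<^sup>+ y. ennreal ((cmod (f (Complex x y)))\<^sup>2) \<partial>lborel"
  have "ennreal (1 / (2 * pi)) * ?I \<le> ennreal ((hardy_norm f)\<^sup>2)"
    unfolding hardy_norm_power2[OF f] hardy_norm_sq_def using x by (intro SUP_upper) auto
  hence "ennreal (2 * pi) * (ennreal (1 / (2 * pi)) * ?I) \<le> ennreal (2 * pi) * ennreal ((hardy_norm f)\<^sup>2)"
    by (rule mult_left_mono) simp
  also have "ennreal (2 * pi) * (ennreal (1 / (2 * pi)) * ?I) = ?I"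
    by (subst mult.assoc[symmetric], subst ennreal_mult[symmetric]) auto
  also have "ennreal (2 * pi) * ennreal ((hardy_norm f)\<^sup>2) = ennreal (2 * pi * (hardy_norm f)\<^sup>2)"
    by (subst ennreal_mult[symmetric]) auto
  finally show ?thesis .
qed

lemma hardy_space_holomorphic: "f \<in> hardy_space \<Longrightarrow> f holomorphic_on {z. Re z > 0}"
  by (simp add: hardy_space_def right_half_plane_def)

lemma continuous_on_vertical_line:
  assumes "f holomorphic_on {z. Re z > 0}" "x > 0"
  shows "continuous_on A (\<lambda>y. f (Complex x y))"
  using assms
  by (intro continuous_on_compose2[OF holomorphic_on_imp_continuous_on[OF assms(1)]])
     (auto intro!: continuous_intros)

text \<open>If \<open>F\<close> is a primitive of \<open>f\<close>, the increments \<open>F (z + \<i> t) - F z\<close> with \<open>0 \<le> t \<le> 1\<close> are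
  bounded on the half-plane; by Cauchy's inequality so are their derivatives
  \<open>f (z + \<i> t) - f z\<close> on smaller half-planes, and averaging over \<open>t\<close> bounds \<open>f z\<close> itself.\<close>

lemma hardy_space_bounded:
  assumes f: "f \<in> hardy_space" and a: "a > 0"
  obtains M where "\<And>z. Re z \<ge> a \<Longrightarrow> cmod (f z) \<le> M"
proof -
  define L where "L = 2 * pi * (hardy_norm f)\<^sup>2"
  \<comment> \<open>This comes from integrating |f| \<open>\<le>\<close> (1 + |f|^2) / 2 over an
    interval of length at most 1.\<close>
  define K where "K = (1 + L) / 2"
  note hol = hardy_space_holomorphic[OF f]
  note cont = continuous_on_vertical_line[OF hol]
  have opn: "open {z. Re z > 0}" by (simp add: open_halfspace_Re_gt)
  have L: "L \<ge> 0" by (simp add: L_def)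
  have int_le: "integral {s..t} (\<lambda>y. cmod (f (Complex x y))) \<le> K"
    if x: "x > 0" and st: "s \<le> t" "t \<le> s + 1" for x s t
  proof -
    let ?g = "\<lambda>y. (cmod (f (Complex x y)))\<^sup>2"
    have cg: "continuous_on A ?g" for A by (intro continuous_intros cont x)
    have gi: "?g integrable_on {s..t}" by (intro integrable_continuous_real cg)
    have "ennreal (integral {s..t} ?g) = (\<integral>\<^sup>+ y. ennreal (indicator {s..t} y * ?g y) \<partial>lborel)"
    proof (rule nn_integral_has_integral_lborel[symmetric])
      show "((\<lambda>y. indicator {s..t} y * ?g y) has_integral integral {s..t} ?g) UNIV"
      proof -
        have "((\<lambda>y. if y \<in> {s..t} then ?g y else 0) has_integral integral {s..t} ?g) UNIV"
          unfolding has_integral_restrict_UNIV by (rule integrable_integral[OF gi])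
        also have "(\<lambda>y. if y \<in> {s..t} then ?g y else 0) = (\<lambda>y. indicator {s..t} y * ?g y)"
          by (auto simp: indicator_def)
        finally show ?thesis .
      qed
    qed (use borel_measurable_continuous_onI[OF cg] in auto)
    also have "\<dots> \<le> (\<integral>\<^sup>+ y. ennreal (?g y) \<partial>lborel)"
      by (intro nn_integral_mono ennreal_leI) (auto simp: indicator_def)
    also have "\<dots> \<le> ennreal L"
      unfolding L_def by (rule hardy_line_integral_le[OF f x])
    finally have gL: "integral {s..t} ?g \<le> L" using L by simp
    have "integral {s..t} (\<lambda>y. cmod (f (Complex x y))) \<le> integral {s..t} (\<lambda>y. (1 + ?g y) / 2)"
    proof (rule integral_le)
      fix y
      show "cmod (f (Complex x y)) \<le> (1 + ?g y) / 2"
        using sum_squares_bound[of 1 "cmod (f (Complex x y))"] by simp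
    qed (auto intro!: integrable_continuous_real continuous_intros cont x)
    also have "\<dots> = ((t - s) + integral {s..t} ?g) / 2"
      using gi st by (subst integral_divide, subst Henstock_Kurzweil_Integration.integral_add) auto
    also have "\<dots> \<le> K" using gL st by (simp add: K_def)
    finally show ?thesis .
  qed
  have K: "K \<ge> 0" using L by (simp add: K_def)
  obtain F where F: "\<And>z. Re z > 0 \<Longrightarrow> (F has_field_derivative f z) (at z)"
  proof -
    obtain G where G: "\<And>z. z \<in> {z. Re z > 0} \<Longrightarrow> (G has_field_derivative f z) (at z within {z. Re z > 0})"
      by (rule holomorphic_convex_primitive'[OF convex_halfspace_Re_gt opn hol]) (rule that, blast)
    show ?thesis
    proof (rule that)
      fix z :: complex assume "Re z > 0"
      thus "(G has_field_derivative f z) (at z)"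
        using G[of z] at_within_open[OF _ opn, of z] by simp
    qed
  qed
  have incr: "cmod (F (z + \<i> * of_real t) - F z) \<le> K" if z: "Re z > 0" and t: "0 \<le> t" "t \<le> 1" for z t
  proof -
    have "((\<lambda>s. \<i> * f (Complex (Re z) s)) has_integral
           F (Complex (Re z) (Im z + t)) - F (Complex (Re z) (Im z))) {Im z..Im z + t}"
    proof (rule fundamental_theorem_of_calculus)
      fix s
      have "((\<lambda>s. Complex (Re z) s) has_vector_derivative \<i>) (at s within {Im z..Im z + t})"
        unfolding Complex_eq by (auto intro!: derivative_eq_intros has_vector_derivative_real_field)
      from field_vector_diff_chain_within[OF this, of F "f (Complex (Re z) s)"]
      show "((\<lambda>s. F (Complex (Re z) s)) has_vector_derivative \<i> * f (Complex (Re z) s)) (at s within {Im z..Im z + t})"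
        using F[of "Complex (Re z) s"] z by (simp add: o_def has_field_derivative_at_within)
    qed (use t in simp)
    hence "F (Complex (Re z) (Im z + t)) - F (Complex (Re z) (Im z)) = integral {Im z..Im z + t} (\<lambda>s. \<i> * f (Complex (Re z) s))"
      by (rule integral_unique[symmetric])
    also have "cmod \<dots> \<le> integral {Im z..Im z + t} (\<lambda>s. cmod (f (Complex (Re z) s)))"
      using z by (intro integral_norm_bound_integral integrable_continuous_real continuous_intros cont)
        (auto simp: norm_mult)
    also have "\<dots> \<le> K" using z t by (intro int_le) auto
    also have "Complex (Re z) (Im z + t) = z + \<i> * of_real t" by (simp add: complex_eq_iff)
    finally show ?thesis by (simp add: complex_surj)
  qed
  \<comment> \<open>The disc of radius \<open>a / 2\<close> about \<open>z\<close> stays inside the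
    half-plane. The increment \<open>D\<close> of the primitive is bounded there by
    \<open>K\<close>, and Cauchy's inequality bounds its derivative at the centre.\<close>
  have diff_le: "cmod (f (z + \<i> * of_real t) - f z) \<le> 2 * K / a"
    if z: "Re z \<ge> a" and t: "0 \<le> t" "t \<le> 1" for z t
  proof -
    define D where "D \<zeta> = F (\<zeta> + \<i> * of_real t) - F \<zeta>" for \<zeta>
    have pos: "Re \<zeta> > 0" if "\<zeta> \<in> cball z (a / 2)" for \<zeta>
      using that z a abs_Re_le_cmod[of "z - \<zeta>"] by (auto simp: dist_norm)
    have der: "(D has_field_derivative f (\<zeta> + \<i> * of_real t) - f \<zeta>) (at \<zeta>)" if "Re \<zeta> > 0" for \<zeta>
      unfolding D_def
      by (rule derivative_eq_intros DERIV_chain2[OF F] F that refl | use that in simp)+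
    have "D holomorphic_on cball z (a / 2)"
      using der pos by (meson field_differentiable_at_within field_differentiable_def holomorphic_on_def)
    hence "cmod ((deriv ^^ 1) D z) \<le> fact 1 * K / (a / 2) ^ 1"
    proof (intro Cauchy_inequality)
      show "D holomorphic_on ball z (a / 2)"
        using \<open>D holomorphic_on cball z (a / 2)\<close> by (rule holomorphic_on_subset) auto
      show "cmod (D \<zeta>) \<le> K" if "cmod (z - \<zeta>) = a / 2" for \<zeta>
        unfolding D_def using that t by (intro incr pos) (auto simp: dist_norm)
      show "continuous_on (cball z (a / 2)) D"
        using \<open>D holomorphic_on cball z (a / 2)\<close> by (rule holomorphic_on_imp_continuous_on)
    qed (use a in simp)
    thus ?thesis using DERIV_imp_deriv[OF der[of z]] z a by (simp add: mult.commute)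
  qed
  show ?thesis
  proof (rule that)
    fix z assume z: "Re z \<ge> a"
    have zpos: "Re z > 0" using z a by simp
    have "cmod (f z) = integral {Im z..Im z + 1} (\<lambda>_. cmod (f z))" by simp
    also have "\<dots> \<le> integral {Im z..Im z + 1} (\<lambda>s. cmod (f (Complex (Re z) s)) + 2 * K / a)"
    proof (rule integral_le)
      fix s assume s: "s \<in> {Im z..Im z + 1}"
      have "z + \<i> * of_real (s - Im z) = Complex (Re z) s" by (simp add: complex_eq_iff)
      hence "cmod (f (Complex (Re z) s) - f z) \<le> 2 * K / a"
        using diff_le[OF z, of "s - Im z"] s by simp
      thus "cmod (f z) \<le> cmod (f (Complex (Re z) s)) + 2 * K / a"
        using norm_triangle_ineq2[of "f z" "f (Complex (Re z) s)"] by (simp add: norm_minus_commute)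
    qed (auto intro!: integrable_continuous_real continuous_intros cont zpos)
    also have "\<dots> = integral {Im z..Im z + 1} (\<lambda>s. cmod (f (Complex (Re z) s))) + 2 * K / a"
      by (subst Henstock_Kurzweil_Integration.integral_add)
         (auto intro!: integrable_continuous_real continuous_intros cont zpos)
    also have "\<dots> \<le> K + 2 * K / a"
      using int_le[OF zpos, of "Im z" "Im z + 1"] by simp
    finally show "cmod (f z) \<le> K + 2 * K / a" .
  qed
qed

text \<open>Poisson's formula is applied to the holomorphic function f^2, and the modulus is then
  moved inside the integral; this replaces an appeal to subharmonicity of |f|^2. The line has
  abscissa \<open>a > 0\<close> because boundedness of \<open>f\<close> is available only on
  half-planes away from the imaginary axis.\<close>

lemma hardy_poisson_le:
  assumes f: "f \<in> hardy_space" and a: "0 < a" "a < Re w"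
  shows "ennreal ((cmod (f w))\<^sup>2) \<le>
    (\<integral>\<^sup>+ y. ennreal ((Re w - a) / pi / (cmod (Complex a y - w))\<^sup>2 * (cmod (f (Complex a y)))\<^sup>2) \<partial>lborel)"
proof -
  define X where "X = Re w - a"
  have X: "X > 0" using a by (simp add: X_def)
  obtain M where M: "\<And>z. Re z \<ge> a \<Longrightarrow> cmod (f z) \<le> M"
    using hardy_space_bounded[OF f a(1)] by blast
  have P: "has_bochner_integral lborel (\<lambda>y. (f (Complex a y))\<^sup>2 / of_real ((cmod (Complex a y - w))\<^sup>2))
           ((f w)\<^sup>2 * of_real (pi / X))"
    unfolding X_def
  proof (rule poisson_formula_shifted[where b = 0 and M = "M\<^sup>2"])
    show "(\<lambda>z. (f z)\<^sup>2) holomorphic_on {z. Re z > 0}"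
      by (intro holomorphic_intros hardy_space_holomorphic[OF f])
    show "cmod ((f z)\<^sup>2) \<le> M\<^sup>2" if "Re z \<ge> a" for z
      using M[OF that] by (simp add: norm_power power_mono)
  qed (use a in auto)
  have eq: "(cmod (f w))\<^sup>2 = X / pi * cmod ((f w)\<^sup>2 * of_real (pi / X))"
    using X by (simp add: norm_mult norm_power norm_divide)
  have "ennreal ((cmod (f w))\<^sup>2) = ennreal (X / pi) * ennreal (cmod ((f w)\<^sup>2 * of_real (pi / X)))"
    unfolding eq using X by (subst ennreal_mult) auto
  also have "\<dots> \<le> ennreal (X / pi) *
      (\<integral>\<^sup>+ y. ennreal (cmod ((f (Complex a y))\<^sup>2 / of_real ((cmod (Complex a y - w))\<^sup>2))) \<partial>lborel)"
    using integral_norm_bound_ennreal[of lborel "\<lambda>y. (f (Complex a y))\<^sup>2 / of_real ((cmod (Complex a y - w))\<^sup>2)"] P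
    unfolding has_bochner_integral_iff by (intro mult_left_mono) auto
  also have "\<dots> = (\<integral>\<^sup>+ y. ennreal (X / pi) *
      ennreal (cmod ((f (Complex a y))\<^sup>2 / of_real ((cmod (Complex a y - w))\<^sup>2))) \<partial>lborel)"
    using P unfolding has_bochner_integral_iff
    by (intro nn_integral_cmult[symmetric] measurable_compose[OF _ measurable_ennreal] borel_measurable_norm) auto
  also have "\<dots> = (\<integral>\<^sup>+ y. ennreal (X / pi / (cmod (Complex a y - w))\<^sup>2 * (cmod (f (Complex a y)))\<^sup>2) \<partial>lborel)"
    using X by (intro nn_integral_cong, subst ennreal_mult[symmetric]) (auto simp: norm_divide norm_power)
  finally show ?thesis by (simp add: X_def)
qed

text \<open>Integrating the Poisson kernel \<open>Re (1 / (\<phi> z - (a + \<i> t))) / \<pi>\<close> along a vertical line gives at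
  most \<open>1 / c\<close>, because \<open>1 / (\<phi> z - (a + \<i> t))\<close> has positive real part and decays like \<open>1 / (c Re z)\<close>.\<close>

lemma hardy_norm_sq_comp_le:
  assumes hol: "\<phi> holomorphic_on right_half_plane" and c: "c > 0"
    and lower: "\<And>z. z \<in> right_half_plane \<Longrightarrow> Re (\<phi> z) \<ge> c * Re z"
    and f: "f \<in> hardy_space"
  shows "hardy_norm_sq (f \<circ> \<phi>) \<le> ennreal (1 / c * (hardy_norm f)\<^sup>2)"
  unfolding hardy_norm_sq_def
proof (rule SUP_least)
  fix x :: real assume "x \<in> {0<..}"
  hence x: "x > 0" by simp
  \<comment> \<open>Half of the available gap is kept in reserve: Re \<open>\<phi>\<close> z exceeds
    \<open>a\<close> as soon as Re z > x/2. Hence the kernel is holomorphic on a region strictly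
    containing the line Re z = x, and the line-integral lemma applies with b = x/2 and K =
    1/c.\<close>
  define a where "a = c * x / 2"
  have a: "a > 0" using c x by (simp add: a_def)
  have hol': "\<phi> holomorphic_on {z. Re z > 0}" using hol by (simp add: right_half_plane_def)
  have Re_phi: "Re (\<phi> z) \<ge> c * Re z" if "Re z > 0" for z
    using lower that by (simp add: right_half_plane_def)
  have gap: "Re (\<phi> z) - a \<ge> c * (Re z - x / 2)" if "Re z > 0" for z
    using Re_phi[OF that] by (simp add: a_def algebra_simps)
  have gap_pos: "Re (\<phi> z) > a" if "Re z > x / 2" for z
  proof -
    have "0 < c * (Re z - x / 2)" using c that by simp
    thus ?thesis using gap[of z] that x by linarith
  qed
  define q where "q t z = 1 / (\<phi> z - Complex a t)" for t z
  define k where "k y t = Re (q t (Complex x y)) / pi" for y t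
  have k_eq: "k y t = (Re (\<phi> (Complex x y)) - a) / pi / (cmod (Complex a t - \<phi> (Complex x y)))\<^sup>2" for y t
    unfolding k_def q_def
    by (simp add: Re_divide cmod_power2 norm_minus_commute[of "Complex a t"])
  have k_nonneg: "k y t \<ge> 0" for y t
    unfolding k_eq using gap_pos[of "Complex x y"] x by (intro divide_nonneg_nonneg) auto
  have cphi: "continuous_on UNIV (\<lambda>y. \<phi> (Complex x y))"
    by (rule continuous_on_vertical_line[OF hol' x])
  have cf: "continuous_on UNIV (\<lambda>t. f (Complex a t))"
    by (rule continuous_on_vertical_line[OF hardy_space_holomorphic[OF f] a])
  have "continuous_on UNIV (\<lambda>(y, t). k y t)"
  proof -
    have nz: "\<phi> (Complex x y) - Complex a t \<noteq> 0" for y t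
      using gap_pos[of "Complex x y"] x by (auto simp: complex_eq_iff)
    show ?thesis
      unfolding k_def q_def case_prod_unfold
      by (intro continuous_intros continuous_on_compose2[OF cphi]) (use nz in \<open>auto intro!: continuous_intros\<close>)
  qed
  hence k_meas[measurable]: "(\<lambda>(y, t). k y t) \<in> borel_measurable (lborel \<Otimes>\<^sub>M lborel)"
    using borel_measurable_continuous_onI[of "\<lambda>(y, t). k y t"]
    by (simp add: lborel_prod measurable_lborel1)
  have f_meas[measurable]: "(\<lambda>t. f (Complex a t)) \<in> borel_measurable borel"
    by (rule borel_measurable_continuous_onI[OF cf])
  have k_int: "(\<integral>\<^sup>+ y. ennreal (k y t) \<partial>lborel) \<le> ennreal (1 / c)" for t
  proof -
    have "(\<integral>\<^sup>+ y. ennreal (Re (q t (Complex x y))) \<partial>lborel) \<le> ennreal (pi * (1 / c))"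
    proof (rule line_integral_positive_real_part_le[where b = "x / 2"])
      show "q t holomorphic_on {z. Re z > x / 2}"
        unfolding q_def using gap_pos x
        by (intro holomorphic_intros holomorphic_on_subset[OF hol']) (force simp: complex_eq_iff)+
      fix z assume z: "Re z \<ge> x"
      have pos: "0 < c * (Re z - x / 2)" "Re z > 0" using c z x by auto
      have "Re (\<phi> z - Complex a t) > 0" using gap_pos[of z] z x by simp
      thus "0 \<le> Re (q t z)"
        unfolding q_def by (simp add: Re_divide)
      have "c * (Re z - x / 2) \<le> cmod (\<phi> z - Complex a t)"
        using gap[OF pos(2)] complex_Re_le_cmod[of "\<phi> z - Complex a t"] by simp
      from frac_le[OF zero_le_one order_refl pos(1) this]
      show "cmod (q t z) \<le> 1 / c / (Re z - x / 2)"
        by (simp add: q_def norm_divide)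
    qed (use x in simp)
    moreover have "ennreal (k y t) = ennreal (1 / pi) * ennreal (Re (q t (Complex x y)))" for y
      using k_nonneg[of y t] pi_gt_zero
      by (subst ennreal_mult[symmetric]) (auto simp: k_def zero_le_divide_iff simp del: pi_gt_zero)
    moreover have "continuous_on UNIV (\<lambda>y. Re (q t (Complex x y)))"
      unfolding q_def using gap_pos[of "Complex x _"] x
      by (intro continuous_intros cphi) (force simp: complex_eq_iff)
    hence "(\<lambda>y. Re (q t (Complex x y))) \<in> borel_measurable borel"
      by (rule borel_measurable_continuous_onI)
    ultimately have "(\<integral>\<^sup>+ y. ennreal (k y t) \<partial>lborel) \<le> ennreal (1 / pi) * ennreal (pi * (1 / c))"
      by (simp add: nn_integral_cmult mult_left_mono)
    also have "\<dots> = ennreal (1 / c)" using c by (subst ennreal_mult[symmetric]) auto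
    finally show ?thesis .
  qed
  have "(\<integral>\<^sup>+ y. ennreal ((cmod ((f \<circ> \<phi>) (Complex x y)))\<^sup>2) \<partial>lborel)
     \<le> (\<integral>\<^sup>+ y. \<integral>\<^sup>+ t. ennreal (k y t) * ennreal ((cmod (f (Complex a t)))\<^sup>2) \<partial>lborel \<partial>lborel)"
  proof (rule nn_integral_mono)
    fix y
    have "a < Re (\<phi> (Complex x y))" using gap_pos[of "Complex x y"] x by simp
    from hardy_poisson_le[OF f a this]
    show "ennreal ((cmod ((f \<circ> \<phi>) (Complex x y)))\<^sup>2) \<le> (\<integral>\<^sup>+ t. ennreal (k y t) * ennreal ((cmod (f (Complex a t)))\<^sup>2) \<partial>lborel)"
      by (simp only: k_eq[symmetric] o_apply ennreal_mult'[OF k_nonneg])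
  qed
  also have "\<dots> = (\<integral>\<^sup>+ t. \<integral>\<^sup>+ y. ennreal (k y t) * ennreal ((cmod (f (Complex a t)))\<^sup>2) \<partial>lborel \<partial>lborel)"
    by (rule lborel_pair.Fubini'[symmetric]) measurable
  also have "\<dots> = (\<integral>\<^sup>+ t. (\<integral>\<^sup>+ y. ennreal (k y t) \<partial>lborel) * ennreal ((cmod (f (Complex a t)))\<^sup>2) \<partial>lborel)"
    by (intro nn_integral_cong nn_integral_multc) measurable
  also have "\<dots> \<le> (\<integral>\<^sup>+ t. ennreal (1 / c) * ennreal ((cmod (f (Complex a t)))\<^sup>2) \<partial>lborel)"
    by (intro nn_integral_mono mult_right_mono k_int) auto
  also have "\<dots> = ennreal (1 / c) * (\<integral>\<^sup>+ t. ennreal ((cmod (f (Complex a t)))\<^sup>2) \<partial>lborel)"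
    by (intro nn_integral_cmult) measurable
  also have "\<dots> \<le> ennreal (1 / c) * ennreal (2 * pi * (hardy_norm f)\<^sup>2)"
    by (intro mult_left_mono hardy_line_integral_le f a) auto
  finally have "ennreal (1 / (2 * pi)) * (\<integral>\<^sup>+ y. ennreal ((cmod ((f \<circ> \<phi>) (Complex x y)))\<^sup>2) \<partial>lborel)
    \<le> ennreal (1 / (2 * pi)) * (ennreal (1 / c) * ennreal (2 * pi * (hardy_norm f)\<^sup>2))"
    by (rule mult_left_mono) simp
  also have "\<dots> = ennreal (1 / c * (hardy_norm f)\<^sup>2)"
  proof -
    have "ennreal (1 / c) * ennreal (2 * pi * (hardy_norm f)\<^sup>2) = ennreal (1 / c * (2 * pi * (hardy_norm f)\<^sup>2))"
      using c by (intro ennreal_mult'[symmetric]) simp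
    moreover have "ennreal (1 / (2 * pi)) * ennreal (1 / c * (2 * pi * (hardy_norm f)\<^sup>2))
        = ennreal (1 / (2 * pi) * (1 / c * (2 * pi * (hardy_norm f)\<^sup>2)))"
      by (intro ennreal_mult'[symmetric]) simp
    ultimately show ?thesis by simp
  qed
  finally show "ennreal (1 / (2 * pi)) * (\<integral>\<^sup>+ y. ennreal ((cmod ((f \<circ> \<phi>) (Complex x y)))\<^sup>2) \<partial>lborel)
    \<le> ennreal (1 / c * (hardy_norm f)\<^sup>2)" .
qed

text \<open>Poisson's formula is applied to \<open>f\<close> times the bounded function \<open>g / (1 + a g)\<close>, where
  \<open>g z = z - 2 a + cnj w\<close> has modulus \<open>\<bar>z - w\<bar>\<close> on the line \<open>Re z = a\<close>. This cancels one of the two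
  factors in the Poisson kernel and so leads to the sharp constant as \<open>a\<close> tends to \<open>0\<close>.\<close>

lemma hardy_point_evaluation:
  assumes f: "f \<in> hardy_space" and w: "Re w > 0"
  shows "(cmod (f w))\<^sup>2 \<le> (hardy_norm f)\<^sup>2 / (2 * Re w)"
proof -
  define N where "N = (hardy_norm f)\<^sup>2"
  have N: "N \<ge> 0" by (simp add: N_def)
  have key: "(cmod (f w))\<^sup>2 \<le> (1 + 2 * a * (Re w - a))\<^sup>2 * N / (2 * (Re w - a))"
    if a: "0 < a" "a < Re w" for a
  proof -
    define X where "X = Re w - a"
    have X: "X > 0" using a by (simp add: X_def)
    have aX: "0 < 1 + 2 * a * X" using X a by (simp add: add_pos_pos)
    define g where "g z = z - 2 * of_real a + cnj w" for z
    \<comment> \<open>As Re g \<open>\<ge>\<close> 0, the modulus of 1 + a g is at least 1 and at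
      least a |g|. The second bound keeps \<open>h\<close> bounded, as Poisson's formula requires;
      the first allows the denominator to be dropped on the line. Using \<open>a\<close> itself as
      regularizing parameter lets a single limit remove both the shift and the
      regularization.\<close>
    define h where "h z = f z * (g z / (1 + of_real a * g z))" for z
    obtain M where M: "\<And>z. Re z \<ge> a \<Longrightarrow> cmod (f z) \<le> M"
      using hardy_space_bounded[OF f a(1)] by blast
    have Re_g: "Re (g z) \<ge> 0" if "Re z > 2 * a - Re w" for z
      using that by (simp add: g_def)
    have den: "cmod (1 + of_real a * u) \<ge> 1" "cmod (1 + of_real a * u) \<ge> a * cmod u" "1 + of_real a * u \<noteq> 0"
      if u: "Re u \<ge> 0" for u
    proof -
      have "1 \<le> Re (1 + of_real a * u)" using u a by simp
      thus "cmod (1 + of_real a * u) \<ge> 1" using complex_Re_le_cmod order_trans by blast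
      have "(a * cmod u)\<^sup>2 \<le> (cmod (1 + of_real a * u))\<^sup>2"
        unfolding power_mult_distrib cmod_power2
        using u a by (simp add: power2_eq_square algebra_simps)
      thus "cmod (1 + of_real a * u) \<ge> a * cmod u"
        by (rule power2_le_imp_le) simp
      show "1 + of_real a * u \<noteq> 0" using \<open>cmod (1 + of_real a * u) \<ge> 1\<close> by auto
    qed
    have P: "has_bochner_integral lborel (\<lambda>y. h (Complex a y) / of_real ((cmod (Complex a y - w))\<^sup>2))
        (h w * of_real (pi / X))"
      unfolding X_def
    \<comment> \<open>Holomorphy of \<open>f\<close> requires Re z > 0 and nonvanishing of the
      denominator is ensured by Re z > 2a - Re w. Both thresholds lie below \<open>a\<close>, since
      0 < a < Re w.\<close>
    proof (rule poisson_formula_shifted[where b = "max 0 (2 * a - Re w)" and M = "M * (1 / a)"])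
      show "h holomorphic_on {z. Re z > max 0 (2 * a - Re w)}"
        unfolding h_def using den(3)[OF Re_g]
        by (intro holomorphic_intros holomorphic_on_subset[OF hardy_space_holomorphic[OF f]])
           (auto simp: g_def intro!: holomorphic_intros)
      show "cmod (h z) \<le> M * (1 / a)" if z: "Re z \<ge> a" for z
      proof -
        have u: "Re (g z) \<ge> 0" using z a by (intro Re_g) simp
        have "cmod (g z) / cmod (1 + of_real a * g z) \<le> 1 / a"
        proof -
          have pos: "cmod (1 + of_real a * g z) > 0" using den(1)[OF u] by linarith
          show ?thesis
            using den(2)[OF u] a by (simp add: pos_divide_le_eq[OF pos] pos_le_divide_eq mult.commute)
        qed
        thus ?thesis unfolding h_def norm_mult norm_divide
          using M[OF z] by (intro mult_mono) (auto intro: order_trans[OF norm_ge_zero])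
      qed
    qed (use a in auto)
    have g_w: "g w = of_real (2 * X)" by (simp add: g_def X_def complex_eq_iff)
    have h_w: "cmod (h w) = cmod (f w) * (2 * X / (1 + 2 * a * X))"
    proof -
      have "h w = f w * of_real (2 * X / (1 + 2 * a * X))"
        by (simp add: h_def g_w mult_ac)
      thus ?thesis using X a by (simp only: norm_mult norm_of_real) simp
    qed
    have g_line: "cmod (g (Complex a y)) = cmod (Complex a y - w)" for y
    proof -
      have "g (Complex a y) = - cnj (Complex a y - w)"
        by (simp add: g_def complex_eq_iff)
      thus ?thesis by (simp only: norm_minus_cancel complex_mod_cnj)
    qed
    have nz: "cmod (Complex a y - w) > 0" for y using a by auto
    define F where "F y = ennreal (cmod (f (Complex a y)))" for y
    define G where "G y = ennreal (1 / cmod (Complex a y - w))" for y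
    have "continuous_on UNIV (\<lambda>y. f (Complex a y))"
      by (rule continuous_on_vertical_line[OF hardy_space_holomorphic[OF f] a(1)])
    hence [measurable]: "(\<lambda>y. f (Complex a y)) \<in> borel_measurable borel"
      by (rule borel_measurable_continuous_onI)
    have "continuous_on UNIV (\<lambda>y. 1 / cmod (Complex a y - w))"
      using nz by (intro continuous_intros) (use a in auto)
    hence [measurable]: "(\<lambda>y. 1 / cmod (Complex a y - w)) \<in> borel_measurable borel"
      by (rule borel_measurable_continuous_onI)
    have F_int: "(\<integral>\<^sup>+ y. (F y)\<^sup>2 \<partial>lborel) \<le> ennreal (2 * pi * N)"
      using hardy_line_integral_le[OF f a(1)] by (simp add: F_def ennreal_power N_def)
    have G_int: "(\<integral>\<^sup>+ y. (G y)\<^sup>2 \<partial>lborel) = ennreal (pi / X)"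
    proof -
      have "has_bochner_integral lborel (\<lambda>y. 1 / (X\<^sup>2 + (y - Im w)\<^sup>2)) (pi / X)"
        by (rule has_bochner_integral_inverse_quadratic[OF X])
      moreover have "(G y)\<^sup>2 = ennreal (1 / (X\<^sup>2 + (y - Im w)\<^sup>2))" for y
        by (simp add: G_def ennreal_power power_divide cmod_power2 X_def power2_commute[of a])
      ultimately show ?thesis
        by (simp add: has_bochner_integral_iff nn_integral_eq_integral)
    qed
    have "ennreal (cmod (f w) * (2 * pi / (1 + 2 * a * X))) = ennreal (cmod (h w * of_real (pi / X)))"
      using X by (simp add: norm_mult norm_divide h_w)
    also have "\<dots> \<le> (\<integral>\<^sup>+ y. ennreal (cmod (h (Complex a y) / of_real ((cmod (Complex a y - w))\<^sup>2))) \<partial>lborel)"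
      using integral_norm_bound_ennreal[of lborel "\<lambda>y. h (Complex a y) / of_real ((cmod (Complex a y - w))\<^sup>2)"] P
      unfolding has_bochner_integral_iff by auto
    also have "\<dots> \<le> (\<integral>\<^sup>+ y. F y * G y \<partial>lborel)"
    proof (rule nn_integral_mono)
      fix y
      have u: "Re (g (Complex a y)) \<ge> 0" using a by (intro Re_g) simp
      have "cmod (h (Complex a y) / of_real ((cmod (Complex a y - w))\<^sup>2))
        = (cmod (f (Complex a y)) * (1 / cmod (Complex a y - w))) / cmod (1 + of_real a * g (Complex a y))"
        unfolding h_def norm_mult norm_divide g_line norm_of_real using nz[of y] by (simp add: power2_eq_square)
      also have "\<dots> \<le> (cmod (f (Complex a y)) * (1 / cmod (Complex a y - w))) / 1"
        using den(1)[OF u] by (intro divide_left_mono) auto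
      finally show "ennreal (cmod (h (Complex a y) / of_real ((cmod (Complex a y - w))\<^sup>2))) \<le> F y * G y"
        unfolding F_def G_def by (subst ennreal_mult[symmetric]) (auto intro: ennreal_leI)
    qed
    finally have "(ennreal (cmod (f w) * (2 * pi / (1 + 2 * a * X))))\<^sup>2 \<le> (\<integral>\<^sup>+ y. F y * G y \<partial>lborel)\<^sup>2"
      by (rule power_mono) simp
    \<comment> \<open>Cauchy-Schwarz separates |f|, controlled by the Hardy norm, from 1/|z - w|,
      whose square has the explicit integral \<open>pi / X\<close>.\<close>
    also have "\<dots> \<le> (\<integral>\<^sup>+ y. (F y)\<^sup>2 \<partial>lborel) * (\<integral>\<^sup>+ y. (G y)\<^sup>2 \<partial>lborel)"
      by (rule Cauchy_Schwarz_nn_integral) (simp_all add: F_def G_def)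
    also have "\<dots> \<le> ennreal (2 * pi * N) * ennreal (pi / X)"
      unfolding G_int by (rule mult_right_mono[OF F_int]) simp
    also have "\<dots> = ennreal (2 * pi * N * (pi / X))"
      using N by (intro ennreal_mult'[symmetric]) simp
    also have "(ennreal (cmod (f w) * (2 * pi / (1 + 2 * a * X))))\<^sup>2 = ennreal ((cmod (f w) * (2 * pi / (1 + 2 * a * X)))\<^sup>2)"
      using X a by (intro ennreal_power mult_nonneg_nonneg divide_nonneg_nonneg) auto
    finally have "(cmod (f w) * (2 * pi / (1 + 2 * a * X)))\<^sup>2 \<le> 2 * pi * N * (pi / X)"
      by (subst (asm) ennreal_le_iff) (use N X in auto)
    hence "(cmod (f w))\<^sup>2 * (2 * pi / (1 + 2 * a * X))\<^sup>2 \<le> 2 * pi * N * (pi / X)"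
      by (simp only: power_mult_distrib)
    hence "(cmod (f w))\<^sup>2 \<le> 2 * pi * N * (pi / X) / (2 * pi / (1 + 2 * a * X))\<^sup>2"
      using aX by (subst pos_le_divide_eq) auto
    also have "\<dots> = (1 + 2 * a * X)\<^sup>2 * N / (2 * X)"
      using X less_imp_neq[OF aX] by (simp add: power_divide power_mult_distrib power2_eq_square)
    finally show ?thesis by (simp add: X_def)
  qed
  have "((\<lambda>a. (1 + 2 * a * (Re w - a))\<^sup>2 * N / (2 * (Re w - a))) \<longlongrightarrow> (1 + 2 * 0 * (Re w - 0))\<^sup>2 * N / (2 * (Re w - 0))) (at_right 0)"
    using w by (intro tendsto_intros) auto
  moreover have "\<forall>\<^sub>F a in at_right 0. (cmod (f w))\<^sup>2 \<le> (1 + 2 * a * (Re w - a))\<^sup>2 * N / (2 * (Re w - a))"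
    using eventually_at_right_less[of 0] eventually_at_right_real[OF w]
    by eventually_elim (use key in auto)
  ultimately show ?thesis
    using tendsto_lowerbound by (fastforce simp: N_def)
qed

text \<open>The normalized line integral at abscissa x is exactly |k|^2 / (2 (x + Re p)), which
  grows as x decreases to 0. For k = 1 the function is the reproducing kernel at
  \<open>p\<close>.\<close>

lemma hardy_norm_sq_kernel_le:
  assumes p: "Re p > 0"
  shows "hardy_norm_sq (\<lambda>z. k / (z + cnj p)) \<le> ennreal ((cmod k)\<^sup>2 / (2 * Re p))"
  unfolding hardy_norm_sq_def
proof (rule SUP_least)
  fix x :: real assume "x \<in> {0<..}"
  hence x: "x > 0" by simp
  have X: "x + Re p > 0" using x p by simp
  have "(cmod (k / (Complex x y + cnj p)))\<^sup>2 = (cmod k)\<^sup>2 * (1 / ((x + Re p)\<^sup>2 + (y - Im p)\<^sup>2))" for y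
    by (simp add: norm_divide power_divide cmod_power2)
  moreover note B = has_bochner_integral_mult_right[OF has_bochner_integral_inverse_quadratic[OF X, of "Im p"], of "(cmod k)\<^sup>2"]
  ultimately have "(\<integral>\<^sup>+ y. ennreal ((cmod (k / (Complex x y + cnj p)))\<^sup>2) \<partial>lborel) = ennreal ((cmod k)\<^sup>2 * (pi / (x + Re p)))"
    by (simp add: has_bochner_integral_iff nn_integral_eq_integral del: integrable_mult_right_iff)
  hence "ennreal (1 / (2 * pi)) * (\<integral>\<^sup>+ y. ennreal ((cmod (k / (Complex x y + cnj p)))\<^sup>2) \<partial>lborel)
     = ennreal ((cmod k)\<^sup>2 / (2 * (x + Re p)))"
    using X by (simp add: ennreal_mult[symmetric])
  also have "\<dots> \<le> ennreal ((cmod k)\<^sup>2 / (2 * Re p))"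
    using x p by (intro ennreal_leI divide_left_mono) auto
  finally show "ennreal (1 / (2 * pi)) * (\<integral>\<^sup>+ y. ennreal ((cmod (k / (Complex x y + cnj p)))\<^sup>2) \<partial>lborel)
     \<le> ennreal ((cmod k)\<^sup>2 / (2 * Re p))" .
qed

lemma hardy_kernel:
  assumes p: "Re p > 0"
  shows "(\<lambda>z. k / (z + cnj p)) \<in> hardy_space"
    and "(hardy_norm (\<lambda>z. k / (z + cnj p)))\<^sup>2 \<le> (cmod k)\<^sup>2 / (2 * Re p)"
proof -
  have "(\<lambda>z. k / (z + cnj p)) holomorphic_on right_half_plane"
    using p by (intro holomorphic_intros) (auto simp: right_half_plane_def complex_eq_iff)
  thus mem: "(\<lambda>z. k / (z + cnj p)) \<in> hardy_space"
    using hardy_norm_sq_kernel_le[OF p, of k]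
    by (simp add: hardy_space_def le_less_trans[OF _ ennreal_less_top])
  show "(hardy_norm (\<lambda>z. k / (z + cnj p)))\<^sup>2 \<le> (cmod k)\<^sup>2 / (2 * Re p)"
    using hardy_norm_sq_kernel_le[OF p, of k] p unfolding hardy_norm_power2[OF mem, symmetric]
    by (subst (asm) ennreal_le_iff) auto
qed

section \<open>Julia's lemma and the angular derivative\<close>

lemma cmod_add_cnj_power2_diff:
  "(cmod (z + cnj w))\<^sup>2 - (cmod (z - w))\<^sup>2 = 4 * Re z * Re w"
  unfolding cmod_power2 by (simp add: power2_eq_square algebra_simps)

text \<open>The Cayley transform \<open>z \<mapsto> (z - w) / (z + cnj w)\<close> maps the half-plane to the unit disc
  and \<open>w\<close> to \<open>0\<close>, which reduces the claim to the Schwarz lemma.\<close>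

lemma half_plane_Schwarz_Pick:
  assumes hol: "\<phi> holomorphic_on right_half_plane"
    and self: "\<phi> ` right_half_plane \<subseteq> right_half_plane"
    and z: "Re z > 0" and w: "Re w > 0"
  shows "cmod (\<phi> z - \<phi> w) / cmod (\<phi> z + cnj (\<phi> w)) \<le> cmod (z - w) / cmod (z + cnj w)"
proof -
  have nz: "u + cnj v \<noteq> 0" if "Re u > 0" "Re v > 0" for u v
    using that by (auto simp: complex_eq_iff)
  have lt: "cmod ((u - v) / (u + cnj v)) < 1" if "Re u > 0" "Re v > 0" for u v
  proof -
    have "(cmod (u - v))\<^sup>2 < (cmod (u + cnj v))\<^sup>2"
      using cmod_add_cnj_power2_diff[of u v] that mult_pos_pos[OF that] by linarith
    thus ?thesis using nz[OF that] by (simp add: norm_divide power2_less_imp_less)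
  qed
  have phi: "Re (\<phi> u) > 0" if "Re u > 0" for u
    using that self by (auto simp: right_half_plane_def)
  \<comment> \<open>\<open>T\<close> inverts the Cayley transform based at \<open>w\<close>.
    Composing with \<open>\<phi>\<close> and with the Cayley transform based at
    \<open>\<phi> w\<close> gives the self-map \<open>g\<close> of the disc fixing 0, to be
    evaluated at the image \<open>\<xi>\<close> of \<open>z\<close>.\<close>
  define T where "T \<zeta> = (w + cnj w * \<zeta>) / (1 - \<zeta>)" for \<zeta>
  have T: "Re (T \<zeta>) > 0" if "cmod \<zeta> < 1" for \<zeta>
  proof -
    have n1: "1 - \<zeta> \<noteq> 0" using that by auto
    have ww: "w + cnj w \<noteq> 0" by (rule nz[OF w w])
    have plus: "T \<zeta> + cnj w = (w + cnj w) / (1 - \<zeta>)" and minus: "T \<zeta> - w = \<zeta> * ((w + cnj w) / (1 - \<zeta>))"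
      using n1 by (simp_all add: T_def field_simps)
    have pos: "cmod ((w + cnj w) / (1 - \<zeta>)) > 0" using n1 ww by simp
    hence "cmod (T \<zeta> - w) < cmod (T \<zeta> + cnj w)"
      unfolding plus minus norm_mult using that by simp
    hence "(cmod (T \<zeta> - w))\<^sup>2 < (cmod (T \<zeta> + cnj w))\<^sup>2"
      by (intro power_strict_mono) auto
    hence "0 < 4 * Re (T \<zeta>) * Re w"
      using cmod_add_cnj_power2_diff[of "T \<zeta>" w] by linarith
    thus ?thesis using w by (simp add: zero_less_mult_iff)
  qed
  define g where "g \<zeta> = (\<phi> (T \<zeta>) - \<phi> w) / (\<phi> (T \<zeta>) + cnj (\<phi> w))" for \<zeta>
  define \<xi> where "\<xi> = (z - w) / (z + cnj w)"
  have "T holomorphic_on ball 0 1"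
    unfolding T_def by (intro holomorphic_intros) auto
  hence hol_T: "(\<lambda>\<zeta>. \<phi> (T \<zeta>)) holomorphic_on ball 0 1"
    using T by (intro holomorphic_on_compose_gen[OF _ hol, unfolded o_def]) (auto simp: right_half_plane_def)
  have "cmod (g \<xi>) \<le> cmod \<xi>"
  proof (rule Schwarz_Lemma(1))
    show "g holomorphic_on ball 0 1"
      unfolding g_def using nz[OF phi[OF T] phi[OF w]] by (intro holomorphic_intros hol_T) auto
    show "g 0 = 0" by (simp add: g_def T_def)
    show "cmod (g \<zeta>) < 1" if "cmod \<zeta> < 1" for \<zeta>
      unfolding g_def by (rule lt[OF phi[OF T[OF that]] phi[OF w]])
    show "cmod \<xi> < 1" unfolding \<xi>_def by (rule lt[OF z w])
  qed
  moreover have "T \<xi> = z"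
  proof -
    have "w + cnj w \<noteq> 0" "z + cnj w \<noteq> 0" using nz z w by auto
    moreover have "1 - \<xi> = (w + cnj w) / (z + cnj w)" "w + cnj w * \<xi> = z * ((w + cnj w) / (z + cnj w))"
      using calculation(2) by (simp_all add: \<xi>_def field_simps)
    ultimately show ?thesis by (simp add: T_def)
  qed
  ultimately show ?thesis by (simp add: g_def \<xi>_def norm_divide)
qed

text \<open>Squaring Schwarz-Pick and replacing |z - w|^2 by |z + cnj w|^2 - 4 Re z Re w, and
  likewise for the images, cancels the common product. The resulting form without quotients is
  suited to rescaling and letting \<open>w\<close> tend to infinity.\<close>

lemma half_plane_Julia:
  assumes "\<phi> holomorphic_on right_half_plane"
    and self: "\<phi> ` right_half_plane \<subseteq> right_half_plane"
    and z: "Re z > 0" and w: "Re w > 0"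
  shows "Re z * Re w * (cmod (\<phi> z + cnj (\<phi> w)))\<^sup>2 \<le> Re (\<phi> z) * Re (\<phi> w) * (cmod (z + cnj w))\<^sup>2"
proof -
  define P where "P = (cmod (\<phi> z + cnj (\<phi> w)))\<^sup>2"
  define p where "p = (cmod (z + cnj w))\<^sup>2"
  have "Re (\<phi> z) > 0" "Re (\<phi> w) > 0"
    using z w self by (auto simp: right_half_plane_def)
  hence pos: "cmod (\<phi> z + cnj (\<phi> w)) > 0" "cmod (z + cnj w) > 0"
    using z w by (auto simp: complex_eq_iff)
  have "cmod (\<phi> z - \<phi> w) * cmod (z + cnj w) \<le> cmod (z - w) * cmod (\<phi> z + cnj (\<phi> w))"
    using half_plane_Schwarz_Pick[OF assms] pos by (simp add: field_simps)
  hence "(cmod (\<phi> z - \<phi> w) * cmod (z + cnj w))\<^sup>2 \<le> (cmod (z - w) * cmod (\<phi> z + cnj (\<phi> w)))\<^sup>2"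
    by (intro power_mono) auto
  moreover have "(cmod (\<phi> z - \<phi> w))\<^sup>2 = P - 4 * Re (\<phi> z) * Re (\<phi> w)" "(cmod (z - w))\<^sup>2 = p - 4 * Re z * Re w"
    using cmod_add_cnj_power2_diff[of z w] cmod_add_cnj_power2_diff[of "\<phi> z" "\<phi> w"]
    by (simp_all add: P_def p_def)
  ultimately have "(P - 4 * Re (\<phi> z) * Re (\<phi> w)) * p \<le> (p - 4 * Re z * Re w) * P"
    by (simp add: power_mult_distrib P_def p_def)
  thus ?thesis unfolding P_def[symmetric] p_def[symmetric] by (simp add: algebra_simps)
qed

section \<open>Angular derivative at infinity versus lower bounds on the real part\<close>

lemma nontangential_positive_integers: "nontangential_to_infinity (\<lambda>n. of_nat (Suc n))"
proof -
  have "filterlim (\<lambda>n. real (Suc n)) at_top sequentially" by real_asymp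
  thus ?thesis by (auto simp: nontangential_to_infinity_def right_half_plane_def intro!: exI[of _ 0])
qed

text \<open>The integers serve as test sequence both for Julia's lemma and for the lower bound on
  the operator norm; \<open>l > 0\<close> allows the limit to be inverted.\<close>

lemma angular_derivative_quotient_lim:
  assumes "has_angular_derivative_at_infinity \<phi> (of_real l)" "l > 0"
  shows "(\<lambda>n. \<phi> (of_nat (Suc n)) / of_nat (Suc n)) \<longlonglongrightarrow> of_real (1 / l)"
proof -
  have "(\<lambda>n. of_nat (Suc n) / \<phi> (of_nat (Suc n))) \<longlonglongrightarrow> of_real l"
    using assms(1) nontangential_positive_integers unfolding has_angular_derivative_at_infinity_def by blast
  from tendsto_inverse[OF this] show ?thesis using assms(2) by (simp add: inverse_eq_divide)
qed

text \<open>Julia's inequality is taken at w = N and divided by N^3. As N tends to infinity,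
  \<open>\<phi>\<close>(N)/N tends to 1/l and (z + N)/N to 1, leaving Re z / l^2
  \<open>\<le>\<close> Re (\<open>\<phi>\<close> z) / l.\<close>

lemma angular_derivative_imp_Re_ge:
  assumes hol: "\<phi> holomorphic_on right_half_plane"
    and self: "\<phi> ` right_half_plane \<subseteq> right_half_plane"
    and ang: "has_angular_derivative_at_infinity \<phi> (of_real l)" and l: "l > 0"
    and z: "z \<in> right_half_plane"
  shows "Re (\<phi> z) \<ge> 1 / l * Re z"
proof -
  have z: "Re z > 0" using z by (simp add: right_half_plane_def)
  define N where "N n = real (Suc n)" for n
  have N: "N n > 0" for n by (simp add: N_def)
  define R where "R n = \<phi> (of_real (N n)) / of_real (N n)" for n
  have R: "R \<longlonglongrightarrow> of_real (1 / l)"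
    using angular_derivative_quotient_lim[OF ang l] unfolding R_def N_def of_real_of_nat_eq .
  have inv0: "(\<lambda>n. of_real (1 / N n)) \<longlonglongrightarrow> (0 :: complex)"
  proof -
    have "(\<lambda>n. 1 / N n) \<longlonglongrightarrow> 0" unfolding N_def by real_asymp
    from tendsto_of_real[OF this, where 'a = complex] show ?thesis by simp
  qed
  have le: "Re z * (cmod (\<phi> z * of_real (1 / N n) + cnj (R n)))\<^sup>2 \<le> Re (\<phi> z) * Re (R n) * (cmod (z * of_real (1 / N n) + 1))\<^sup>2" for n
  proof -
    have e1: "\<phi> z + cnj (\<phi> (of_real (N n))) = of_real (N n) * (\<phi> z * of_real (1 / N n) + cnj (R n))"
      and e2: "z + cnj (of_real (N n)) = of_real (N n) * (z * of_real (1 / N n) + 1)"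
      and e3: "Re (\<phi> (of_real (N n))) = N n * Re (R n)"
      using N[of n] by (simp_all add: R_def algebra_simps)
    have "N n ^ 3 * (Re z * (cmod (\<phi> z * of_real (1 / N n) + cnj (R n)))\<^sup>2)
        \<le> N n ^ 3 * (Re (\<phi> z) * Re (R n) * (cmod (z * of_real (1 / N n) + 1))\<^sup>2)"
      using half_plane_Julia[OF hol self z, of "of_real (N n)"] N[of n]
      unfolding e1 e2 e3 norm_mult power_mult_distrib
      by (simp add: power2_eq_square power3_eq_cube mult_ac)
    thus ?thesis using N[of n] by simp
  qed
  have "Re z * (cmod (\<phi> z * 0 + cnj (of_real (1 / l))))\<^sup>2 \<le> Re (\<phi> z) * Re (of_real (1 / l)) * (cmod (z * 0 + 1))\<^sup>2"
  proof (rule LIMSEQ_le)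
    show "(\<lambda>n. Re z * (cmod (\<phi> z * of_real (1 / N n) + cnj (R n)))\<^sup>2)
        \<longlonglongrightarrow> Re z * (cmod (\<phi> z * 0 + cnj (of_real (1 / l))))\<^sup>2"
      by (intro tendsto_mult tendsto_const tendsto_power tendsto_norm tendsto_add tendsto_cnj R inv0)
    show "(\<lambda>n. Re (\<phi> z) * Re (R n) * (cmod (z * of_real (1 / N n) + 1))\<^sup>2)
        \<longlonglongrightarrow> Re (\<phi> z) * Re (of_real (1 / l)) * (cmod (z * 0 + 1))\<^sup>2"
      by (intro tendsto_mult tendsto_const tendsto_power tendsto_norm tendsto_add tendsto_Re R inv0)
  qed (use le in blast)
  thus ?thesis using l by (simp add: power2_eq_square field_simps norm_divide)
qed

text \<open>Julia's inequality is applied to \<open>\<psi> z = \<phi> z - (c - \<delta>) z\<close> and a point \<open>w\<close> with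
  \<open>Re (\<psi> w) \<le> 2 \<delta> Re w\<close>; since \<open>Re (\<psi> z) \<le> \<bar>\<psi> z + cnj (\<psi> w)\<bar>\<close>, one factor can be divided out.\<close>

lemma half_plane_growth_bound:
  assumes hol: "\<phi> holomorphic_on right_half_plane"
    and lower: "\<And>z. Re z > 0 \<Longrightarrow> Re (\<phi> z) \<ge> c * Re z"
    and \<delta>: "\<delta> > 0" and w: "Re w > 0" "Re (\<phi> w) \<le> (c + \<delta>) * Re w" and z: "Re z > 0"
  defines "\<psi> \<equiv> \<lambda>z. \<phi> z - of_real (c - \<delta>) * z"
  shows "cmod (\<psi> z) \<le> cmod (\<psi> w) + 2 * \<delta> * (cmod (z + cnj w))\<^sup>2 / Re z"
proof -
  \<comment> \<open>Subtracting (c - \<open>\<delta>\<close>) z instead of c z leaves a strictly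
    positive real part, so Julia's inequality applies to \<open>\<psi>\<close>.\<close>
  have pos: "Re (\<psi> u) > 0" if "Re u > 0" for u
  proof -
    have "0 < \<delta> * Re u" using \<delta> that by simp
    thus ?thesis using lower[OF that] by (simp add: \<psi>_def algebra_simps)
  qed
  have "\<psi> holomorphic_on right_half_plane" unfolding \<psi>_def by (intro holomorphic_intros hol)
  moreover have "\<psi> ` right_half_plane \<subseteq> right_half_plane"
    using pos by (auto simp: right_half_plane_def)
  ultimately have J: "Re z * Re w * (cmod (\<psi> z + cnj (\<psi> w)))\<^sup>2 \<le> Re (\<psi> z) * Re (\<psi> w) * (cmod (z + cnj w))\<^sup>2"
    by (rule half_plane_Julia) (use z w in auto)
  define A where "A = cmod (\<psi> z + cnj (\<psi> w))"
  have "Re (\<psi> z + cnj (\<psi> w)) \<le> A" unfolding A_def by (rule complex_Re_le_cmod)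
  hence A: "Re (\<psi> z) \<le> A" "A > 0" using pos[OF w(1)] pos[OF z] by auto
  have \<psi>w: "Re (\<psi> w) \<le> 2 * \<delta> * Re w" using w by (simp add: \<psi>_def algebra_simps)
  have "Re (\<psi> z) * Re (\<psi> w) * (cmod (z + cnj w))\<^sup>2 \<le> A * (2 * \<delta> * Re w) * (cmod (z + cnj w))\<^sup>2"
    using A \<psi>w pos[OF w(1)] by (intro mult_right_mono mult_mono) auto
  with J have "(A * Re w) * (Re z * A) \<le> (A * Re w) * (2 * \<delta> * (cmod (z + cnj w))\<^sup>2)"
    unfolding A_def[symmetric] by (simp add: power2_eq_square mult_ac)
  hence "Re z * A \<le> 2 * \<delta> * (cmod (z + cnj w))\<^sup>2"
    using A w by (subst (asm) mult_le_cancel_left_pos) auto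
  hence "A \<le> 2 * \<delta> * (cmod (z + cnj w))\<^sup>2 / Re z"
    using z by (simp add: field_simps)
  moreover have "cmod (\<psi> z) \<le> A + cmod (\<psi> w)"
    unfolding A_def using norm_triangle_ineq4[of "\<psi> z + cnj (\<psi> w)" "cnj (\<psi> w)"] by simp
  ultimately show ?thesis by linarith
qed

text \<open>With c the infimum of Re (\<open>\<phi>\<close> z) / Re z, a point \<open>w\<close>
  whose quotient is within \<open>\<delta>\<close> of c is fixed. The growth bound then shows that,
  in a cone, \<open>\<phi>\<close> z differs from c z by O(\<open>\<delta>\<close> |z|) up to terms
  of lower order, so \<open>\<phi>\<close> z / z tends to c and the derivative is 1/c.\<close>

lemma Re_ge_imp_angular_derivative:
  assumes hol: "\<phi> holomorphic_on right_half_plane" and k: "k > 0"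
    and lower: "\<And>z. Re z > 0 \<Longrightarrow> Re (\<phi> z) \<ge> k * Re z"
  shows "\<exists>l::real. 0 < l \<and> has_angular_derivative_at_infinity \<phi> (complex_of_real l)"
proof -
  define Q where "Q = (\<lambda>z. Re (\<phi> z) / Re z) ` {z. Re z > 0}"
  define c where "c = Inf Q"
  have Qk: "k \<le> q" if "q \<in> Q" for q
    using that lower by (auto simp: Q_def pos_le_divide_eq)
  have Q: "Q \<noteq> {}" "bdd_below Q"
  proof -
    show "Q \<noteq> {}" by (auto simp: Q_def intro: exI[of _ 1])
    show "bdd_below Q" by (rule bdd_belowI[of _ k]) (rule Qk)
  qed
  have c: "c > 0" using k cInf_greatest[OF Q(1) Qk] by (simp add: c_def)
  have c_le: "c * Re z \<le> Re (\<phi> z)" if "Re z > 0" for z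
    using cInf_lower[OF _ Q(2), of "Re (\<phi> z) / Re z"] that
    by (auto simp: Q_def c_def pos_le_divide_eq)
  have lim: "(\<lambda>n. \<phi> (z n) / z n) \<longlonglongrightarrow> of_real c" if nt: "nontangential_to_infinity z" for z
  proof (rule tendstoI)
    fix e :: real assume e: "e > 0"
    have zpos: "Re (z n) > 0" for n using nt by (auto simp: nontangential_to_infinity_def right_half_plane_def)
    obtain M0 where M0': "\<And>n. \<bar>Im (z n)\<bar> / Re (z n) \<le> M0"
      using nt by (auto simp: nontangential_to_infinity_def)
    have M0: "\<bar>Im (z n)\<bar> \<le> M0 * Re (z n)" for n using M0'[of n] zpos[of n] by (simp add: pos_divide_le_eq)
    define M where "M = max 0 M0"
    have M: "\<bar>Im (z n)\<bar> \<le> M * Re (z n)" "M \<ge> 0" for n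
      using M0[of n] mult_right_mono[of M0 M "Re (z n)"] zpos[of n] by (auto simp: M_def intro: order_trans)
    have cone: "cmod (z n) \<le> (1 + M) * Re (z n)" for n
      using cmod_le[of "z n"] M(1)[of n] zpos[of n] by (simp add: algebra_simps)
    \<comment> \<open>The error bound \<open>B\<close> tends to \<open>\<delta>\<close> (3 + 2 M),
      which is strictly below e = \<open>\<delta>\<close> (4 + 2 M).\<close>
    define \<delta> where "\<delta> = e / (4 + 2 * M)"
    have \<delta>: "\<delta> > 0" using e M(2) by (simp add: \<delta>_def)
    have "\<exists>q\<in>Q. q < c + \<delta>"
      using cInf_lessD[OF Q(1), of "c + \<delta>"] \<delta> by (auto simp: c_def)
    then obtain w where w: "Re w > 0" "Re (\<phi> w) < (c + \<delta>) * Re w"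
      by (auto simp: Q_def pos_divide_less_eq)
    define \<psi> where "\<psi> z = \<phi> z - of_real (c - \<delta>) * z" for z
    \<comment> \<open>The three terms account for replacing c - \<open>\<delta>\<close> by c, for
      the constant |\<open>\<psi>\<close> w|, and for the quadratic term of the growth bound, where
      the cone condition turns 1 / Re z into (1 + M) / r.\<close>
    define B where "B r = \<delta> + cmod (\<psi> w) / r + 2 * \<delta> * (1 + M) * (1 + cmod w / r)\<^sup>2" for r
    have bound: "dist (\<phi> (z n) / z n) (of_real c) \<le> B (cmod (z n))" for n
    proof -
      define r where "r = cmod (z n)"
      have r: "r > 0" "z n \<noteq> 0" using zpos[of n] by (auto simp: r_def)
      have "\<phi> (z n) / z n - of_real c = \<psi> (z n) / z n - of_real \<delta>"
        using r by (simp add: \<psi>_def field_simps)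
      hence "dist (\<phi> (z n) / z n) (of_real c) \<le> cmod (\<psi> (z n)) / r + \<delta>"
        using norm_triangle_ineq4[of "\<psi> (z n) / z n" "of_real \<delta>"] \<delta> by (simp add: dist_norm norm_divide r_def)
      also have "cmod (\<psi> (z n)) \<le> cmod (\<psi> w) + 2 * \<delta> * (cmod (z n + cnj w))\<^sup>2 / Re (z n)"
        unfolding \<psi>_def using w by (intro half_plane_growth_bound hol c_le \<delta> zpos) auto
      also have "2 * \<delta> * (cmod (z n + cnj w))\<^sup>2 / Re (z n) \<le> 2 * \<delta> * (r + cmod w)\<^sup>2 / Re (z n)"
        using norm_triangle_ineq[of "z n" "cnj w"] \<delta> zpos[of n]
        by (intro divide_right_mono mult_left_mono power_mono) (auto simp: r_def)
      also have "\<dots> \<le> 2 * \<delta> * (r + cmod w)\<^sup>2 * ((1 + M) / r)"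
      proof -
        have "1 / Re (z n) \<le> (1 + M) / r"
          using cone[of n] zpos[of n] r by (simp add: r_def field_simps)
        hence "2 * \<delta> * (r + cmod w)\<^sup>2 * (1 / Re (z n)) \<le> 2 * \<delta> * (r + cmod w)\<^sup>2 * ((1 + M) / r)"
          using \<delta> by (intro mult_left_mono) auto
        thus ?thesis by simp
      qed
      finally have "dist (\<phi> (z n) / z n) (of_real c)
          \<le> (cmod (\<psi> w) + 2 * \<delta> * (r + cmod w)\<^sup>2 * ((1 + M) / r)) / r + \<delta>"
        using r by (simp add: divide_right_mono)
      also have "\<dots> = B r"
        using r by (simp add: B_def field_simps power2_eq_square)
      finally show ?thesis by (simp add: r_def)
    qed
    have z_inf: "filterlim (\<lambda>n. cmod (z n)) at_top sequentially"
      using nt by (auto simp: nontangential_to_infinity_def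
          intro: filterlim_at_top_mono[OF _ always_eventually] complex_Re_le_cmod)
    have "(B \<longlongrightarrow> \<delta> + 2 * \<delta> * (1 + M)) at_top"
      unfolding B_def by real_asymp
    hence "(\<lambda>n. B (cmod (z n))) \<longlonglongrightarrow> \<delta> + 2 * \<delta> * (1 + M)"
      using z_inf by (rule filterlim_compose)
    moreover have "\<delta> + 2 * \<delta> * (1 + M) < e"
    proof -
      have "\<delta> * (4 + 2 * M) = e" using M(2) by (simp add: \<delta>_def)
      thus ?thesis using \<delta> by (simp add: algebra_simps)
    qed
    ultimately have "\<forall>\<^sub>F n in sequentially. B (cmod (z n)) < e"
      by (rule order_tendstoD)
    thus "\<forall>\<^sub>F n in sequentially. dist (\<phi> (z n) / z n) (of_real c) < e"
      by (rule eventually_mono) (use bound in \<open>auto intro: le_less_trans\<close>)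
  qed
  have "fixes_infinity \<phi>"
    unfolding fixes_infinity_def
  proof (intro allI impI)
    fix z assume nt: "nontangential_to_infinity z"
    hence zpos: "Re (z n) > 0" for n by (auto simp: nontangential_to_infinity_def right_half_plane_def)
    have "filterlim (\<lambda>n. c * Re (z n)) at_top sequentially"
      using nt c by (auto simp: nontangential_to_infinity_def intro: filterlim_tendsto_pos_mult_at_top)
    hence "filterlim (\<lambda>n. cmod (\<phi> (z n))) at_top sequentially"
      using c_le[OF zpos] by (elim filterlim_at_top_mono)
        (auto intro!: always_eventually intro: order_trans[OF _ complex_Re_le_cmod])
    thus "filterlim (\<lambda>n. \<phi> (z n)) at_infinity sequentially"
      by (rule filterlim_norm_at_top_imp_at_infinity)
  qed
  moreover have "(\<lambda>n. z n / \<phi> (z n)) \<longlonglongrightarrow> of_real (1 / c)" if "nontangential_to_infinity z" for z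
    using tendsto_inverse[OF lim[OF that]] c by (simp add: inverse_eq_divide)
  ultimately have "has_angular_derivative_at_infinity \<phi> (complex_of_real (1 / c))"
    by (simp add: has_angular_derivative_at_infinity_def)
  thus ?thesis using c by (intro exI[of _ "1 / c"]) simp
qed

section \<open>Composition operators\<close>

text \<open>The adjoint of \<open>C\<^sub>\<phi>\<close> maps the reproducing kernel at \<open>w\<close> to the one at \<open>\<phi> w\<close>; here
  this is exploited by testing \<open>C\<^sub>\<phi>\<close> on the normalized kernel at \<open>\<phi> w\<close>.\<close>

lemma comp_bound_imp_Re_ge:
  assumes bound: "\<And>f. f \<in> hardy_space \<Longrightarrow> hardy_norm f \<le> 1 \<Longrightarrow> f \<circ> \<phi> \<in> hardy_space \<and> hardy_norm (f \<circ> \<phi>) \<le> C"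
    and w: "Re w > 0" and p: "Re (\<phi> w) > 0"
  shows "Re w \<le> C\<^sup>2 * Re (\<phi> w)"
proof -
  define p where "p = \<phi> w"
  \<comment> \<open>This constant gives the kernel at \<open>p\<close> norm at most 1, while its
    value at \<open>p\<close> has square 1 / (2 Re p); point evaluation of
    \<open>f \<circ> \<phi>\<close> at \<open>w\<close> then compares the two real parts.\<close>
  define k where "k = sqrt (2 * Re p)"
  define f where "f z = of_real k / (z + cnj p)" for z
  have p: "Re p > 0" using p by (simp add: p_def)
  have k2: "k\<^sup>2 = 2 * Re p" using p by (simp add: k_def)
  have f: "f \<in> hardy_space" unfolding f_def by (rule hardy_kernel(1)[OF p])
  have "(hardy_norm f)\<^sup>2 \<le> 1"
    using hardy_kernel(2)[OF p, of "of_real k"] p k2 unfolding f_def by simp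
  hence "hardy_norm f \<le> 1" by (simp add: power2_le_imp_le[of _ 1])
  from bound[OF f this] have g: "f \<circ> \<phi> \<in> hardy_space" "hardy_norm (f \<circ> \<phi>) \<le> C" by auto
  have "p + cnj p = of_real (2 * Re p)" by (simp add: complex_add_cnj)
  hence "(cmod ((f \<circ> \<phi>) w))\<^sup>2 = k\<^sup>2 / (2 * Re p)\<^sup>2"
    using p by (simp add: f_def p_def norm_divide power_divide norm_mult power_mult_distrib)
  hence "1 / (2 * Re p) \<le> (hardy_norm (f \<circ> \<phi>))\<^sup>2 / (2 * Re w)"
    using hardy_point_evaluation[OF g(1) w] p unfolding k2 by (simp add: power2_eq_square)
  also have "\<dots> \<le> C\<^sup>2 / (2 * Re w)"
    using g(2) w by (intro divide_right_mono power_mono) (auto simp: hardy_norm_def)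
  finally show ?thesis using p w by (simp add: field_simps p_def)
qed

lemma hardy_comp_bounded:
  assumes hol: "\<phi> holomorphic_on right_half_plane"
    and self: "\<phi> ` right_half_plane \<subseteq> right_half_plane" and c: "c > 0"
    and lower: "\<And>z. z \<in> right_half_plane \<Longrightarrow> Re (\<phi> z) \<ge> c * Re z"
    and f: "f \<in> hardy_space"
  shows "f \<circ> \<phi> \<in> hardy_space" "hardy_norm (f \<circ> \<phi>) \<le> sqrt (1 / c) * hardy_norm f"
proof -
  have le: "hardy_norm_sq (f \<circ> \<phi>) \<le> ennreal (1 / c * (hardy_norm f)\<^sup>2)"
    by (rule hardy_norm_sq_comp_le[OF hol c lower f])
  have "f \<circ> \<phi> holomorphic_on right_half_plane"
    using f self by (intro holomorphic_on_compose_gen[OF hol]) (auto simp: hardy_space_def)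
  thus mem: "f \<circ> \<phi> \<in> hardy_space"
    using le by (simp add: hardy_space_def le_less_trans[OF _ ennreal_less_top])
  have "(hardy_norm (f \<circ> \<phi>))\<^sup>2 \<le> 1 / c * (hardy_norm f)\<^sup>2"
    using le c unfolding hardy_norm_power2[OF mem, symmetric] by (subst (asm) ennreal_le_iff) auto
  also have "\<dots> = (sqrt (1 / c) * hardy_norm f)\<^sup>2"
    using c by (simp add: power_mult_distrib)
  finally show "hardy_norm (f \<circ> \<phi>) \<le> sqrt (1 / c) * hardy_norm f"
    by (rule power2_le_imp_le) (use c in \<open>simp add: hardy_norm_def\<close>)
qed

theorem theorem3p1:
  fixes \<phi> :: "complex \<Rightarrow> complex"
  assumes "\<phi> holomorphic_on right_half_plane"
    and "\<phi> ` right_half_plane \<subseteq> right_half_plane"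
  shows "(bounded_hardy_operator (composition_operator \<phi>) \<longleftrightarrow>
            (\<exists>l::real. 0 < l \<and> has_angular_derivative_at_infinity \<phi> (complex_of_real l))) \<and>
         (\<forall>l::real. 0 < l \<and> has_angular_derivative_at_infinity \<phi> (complex_of_real l) \<longrightarrow>
            hardy_operator_norm (composition_operator \<phi>) = sqrt l)"
proof (intro conjI iffI allI impI)
  have phi: "Re (\<phi> z) > 0" if "Re z > 0" for z
    using assms(2) that by (auto simp: right_half_plane_def)
  have T_eq: "composition_operator \<phi> f = f \<circ> \<phi>" for f
    by (simp add: composition_operator_def)
  have upper: "f \<circ> \<phi> \<in> hardy_space" "hardy_norm (f \<circ> \<phi>) \<le> sqrt l * hardy_norm f"
    if "0 < l" "has_angular_derivative_at_infinity \<phi> (complex_of_real l)" "f \<in> hardy_space" for f l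
    using hardy_comp_bounded[OF assms _ angular_derivative_imp_Re_ge[OF assms that(2,1)] that(3)] that(1)
    by auto
  {
    assume "bounded_hardy_operator (composition_operator \<phi>)"
    then obtain C where mem: "\<And>f. f \<in> hardy_space \<Longrightarrow> f \<circ> \<phi> \<in> hardy_space"
      and C: "\<And>f. f \<in> hardy_space \<Longrightarrow> hardy_norm (f \<circ> \<phi>) \<le> C * hardy_norm f"
      unfolding bounded_hardy_operator_def T_eq by blast
    \<comment> \<open>The sign of \<open>C\<close> is not known in advance, so passing to the unit
      ball requires its absolute value.\<close>
    have "hardy_norm (f \<circ> \<phi>) \<le> \<bar>C\<bar>" if "f \<in> hardy_space" "hardy_norm f \<le> 1" for f
    proof -
      have "hardy_norm f \<ge> 0" by (simp add: hardy_norm_def)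
      hence "C * hardy_norm f \<le> \<bar>C\<bar> * 1" using that(2) by (intro mult_mono) auto
      thus ?thesis using C[OF that(1)] by simp
    qed
    hence le: "Re w \<le> \<bar>C\<bar>\<^sup>2 * Re (\<phi> w)" if "Re w > 0" for w
      using mem phi that by (intro comp_bound_imp_Re_ge) auto
    have "C\<^sup>2 > 0" using le[of 1] by (cases "C = 0") auto
    moreover from this have "1 / C\<^sup>2 * Re w \<le> Re (\<phi> w)" if "Re w > 0" for w
      using le[OF that] by (simp add: field_simps)
    ultimately show "\<exists>l::real. 0 < l \<and> has_angular_derivative_at_infinity \<phi> (complex_of_real l)"
      by (intro Re_ge_imp_angular_derivative[OF assms(1), of "1 / C\<^sup>2"]) auto
  next
    assume "\<exists>l::real. 0 < l \<and> has_angular_derivative_at_infinity \<phi> (complex_of_real l)"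
    then obtain l :: real where "0 < l" "has_angular_derivative_at_infinity \<phi> (complex_of_real l)"
      by blast
    from upper[OF this] show "bounded_hardy_operator (composition_operator \<phi>)"
      unfolding bounded_hardy_operator_def T_eq by auto
  next
    fix l :: real assume "0 < l \<and> has_angular_derivative_at_infinity \<phi> (complex_of_real l)"
    hence l: "0 < l" and ang: "has_angular_derivative_at_infinity \<phi> (complex_of_real l)" by auto
    define U where "U = {f \<in> hardy_space. hardy_norm f \<le> 1}"
    define N where "N = (SUP f\<in>U. hardy_norm (f \<circ> \<phi>))"
    have U_le: "hardy_norm (f \<circ> \<phi>) \<le> sqrt l" if "f \<in> U" for f
    proof -
      have "sqrt l * hardy_norm f \<le> sqrt l * 1" using that l by (intro mult_left_mono) (auto simp: U_def)
      thus ?thesis using upper(2)[OF l ang, of f] that by (simp add: U_def)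
    qed
    \<comment> \<open>A real supremum carries information only for a nonempty set bounded above; the
      zero function supplies nonemptiness and also \<open>N \<ge> 0\<close>.\<close>
    have bdd: "bdd_above ((\<lambda>f. hardy_norm (f \<circ> \<phi>)) ` U)"
      using U_le by (auto intro: bdd_aboveI[of _ "sqrt l"])
    have N_ub: "hardy_norm (f \<circ> \<phi>) \<le> N" if "f \<in> U" for f
      unfolding N_def using bdd that by (intro cSUP_upper)
    have zero: "(\<lambda>_. 0) \<in> U"
      by (simp add: U_def hardy_space_def hardy_norm_def hardy_norm_sq_def)
    have "N \<le> sqrt l"
      unfolding N_def using zero U_le by (intro cSUP_least) auto
    moreover have "sqrt l \<le> N"
    proof (rule real_le_lsqrt)
      show "N \<ge> 0" using N_ub[OF zero] by (simp add: hardy_norm_def hardy_norm_sq_def o_def)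
      \<comment> \<open>The kernel estimate needs only a bound on the unit ball, so the supremum
        \<open>N\<close> itself can serve as the constant. Taking w to be a positive integer,
        dividing by it and passing to the limit gives 1 \<open>\<le>\<close> N^2 / l.\<close>
      have "Re w \<le> N\<^sup>2 * Re (\<phi> w)" if "Re w > 0" for w
        using N_ub upper(1)[OF l ang] phi[OF that] that by (intro comp_bound_imp_Re_ge) (auto simp: U_def)
      from this[of "of_nat (Suc _)"]
      have le: "1 \<le> N\<^sup>2 * Re (\<phi> (of_nat (Suc n)) / of_nat (Suc n))" for n
        by (simp add: Re_divide_of_nat field_simps del: of_nat_Suc)
      have "(\<lambda>n. N\<^sup>2 * Re (\<phi> (of_nat (Suc n)) / of_nat (Suc n))) \<longlonglongrightarrow> N\<^sup>2 * Re (of_real (1 / l))"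
        by (intro tendsto_intros angular_derivative_quotient_lim[OF ang l])
      hence "1 \<le> N\<^sup>2 * Re (of_real (1 / l))"
        by (rule LIMSEQ_le_const) (use le in blast)
      thus "l \<le> N\<^sup>2" using l by (simp add: field_simps)
    qed
    ultimately show "hardy_operator_norm (composition_operator \<phi>) = sqrt l"
      by (simp add: hardy_operator_norm_def T_eq N_def U_def)
  }
qed

end
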